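(* Let $\mathcal{G}$ be a Brauer graph, $A_{\mathcal{G}}=\Bbbk Q_{\mathcal{G}}/I_{\mathcal{G}}$ its corresponding Brauer graph algebra and $G_{Q_{\mathcal{G}},I_{\mathcal{G}}}$ the ramifications graph of $A_{\mathcal{G}}$. Then the weakly connected components of $G_{Q_{\mathcal{G}},I_{\mathcal{G}}}$ are in bijection with the non-truncated vertices of $\mathcal{G}$, in such a way that if $v$ is the non-truncated vertex corresponding to a component $N$, then $\omega(N)=A_{v,\widehat{i}}$ for some edge $i$ of $\mathcal{G}$ incident to $v$ (and some half-edge $\widehat i$ of $i$ incident to $v$). Moreover, each one of the weakly connected components of $G_{Q_{\mathcal{G}},I_{\mathcal{G}}}$ is just a vertex or is an oriented cycle $\bullet\to\bullet\to\cdots\to\bullet\to\bullet$ returning from the last vertex to the first one.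
   Context: Brauer graphs. A Brauer graph is $\mathcal G=(V,E,m,\mathfrak o)$ where: $(V,E)$ is a finite connected graph (loops and multiple edges allowed, at least one edge); $val(v)$ is the number of half-edges incident to $v\in V$; $m:V\to\mathbb Z^+$ is the multiplicity function; a vertex $v$ is truncated if $val(v)m(v)=1$; $V^*$ is the set of non-truncated vertices; $\mathfrak o$ assigns to each $v\in V^*$ a cyclic order $i_0<i_1<\cdots<i_{val(v)-1}<i_0$ on the half-edges incident to $v$ (so a loop at $v$ appears twice; if $val(v)=1$ the order is $i<i$). The next element in the cyclic order is called the successor. The half-edges of an edge $i$ are written $\widehat i$ and $\widetilde i$. Brauer graph algebra. $\Bbbk$ is an algebraically closed field. $A_{\mathcal G}=\Bbbk Q_{\mathcal G}/I_{\mathcal G}$, where $Q_{\mathcal G}$ has vertex set $E$ and, for each $v\in V^*$ and each half-edge at $v$, one arrow from the corresponding edge $i$ to the edge $j$ of its successor in the cyclic order at $v$. For $v\in V^*$ and a half-edge $\widehat i$ of $i$ incident to $v$, the successor sequence of $v$ starting at $\widehat i$ gives a cyclic path $A_{v,\widehat i}=\alpha_0\cdots\alpha_{val(v)-1}$ starting at $i$, called a special $v$-cycle. $w^{(p)}$ denotes the $p$-th power of a cyclic path $w$. $I_{\mathcal G}$ is generated by: (I) $A_{v,\widehat i}^{(m(v))}-A_{v',\widetilde i}^{(m(v'))}$, where $i$ is an edge linking non-truncated vertices $v,v'$ and $\widehat i,\widetilde i$ are its half-edges incident to $v$ and $v'$ respectively; (II) $A_{v,\widehat i}^{(m(v))}A_{v,\widehat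 i}^0$, where $v\in V^*$, $\widehat i$ is a half-edge at $v$ and $A_{v,\widehat i}^0$ is the first arrow of $A_{v,\widehat i}$; (III) $\alpha\beta$, for arrows $\alpha,\beta$ such that $\alpha\beta$ is not a subpath of any special cycle, except if $\alpha=\beta$ is a loop corresponding to a non-truncated vertex $v$ with $val(v)=1$. Ramifications graph. Paths are composed left to right. For a bound quiver algebra $\Bbbk Q/I$, a non-trivial path $w$ is factored into arrows as $w=w^0\cdots w^{l_w}$. $Q$ is a cyclic quiver if it consists of pairwise distinct vertices in a single oriented cycle with arrows $\alpha_0,\dots,\alpha_k$ ($k\ge0$; a single loop if $k=0$). If $Q$ is cyclic, fix one path $\alpha_0\cdots\alpha_k$ running once through all the arrows and put $\omega_a:=\alpha_0\cdots\alpha_k$ for all arrows $a$. If $Q$ is not cyclic, $\omega_a$ is the (unique) path of maximal length among the paths $\omega$ containing $a$ as a subpath and such that for every $0\le j<l_\omega$ exactly one arrow of $Q$ starts at $t(\omega^j)$ and exactly one arrow ends at $t(\omega^j)$. Put $l_a=l_{\omega_a}$. $G_{Q,I}$ is the oriented graph with vertices the paths $\omega_a$, $a\in Q_1$, and an edge from $\omega_a$ to $\omega_b$ iff $\omega_a\neq\omega_b$, $t(\omega_a)=s(\omega_b)$ and $\omega_a^{l_a}\omega_b^0\notin I$ (last arrow of $\omega_a$ followed by first arrow of $\omega_b$). The path $\omega(N)$. $A_{\mathcal G}$ is special multiserial (for each arrow $\alpha$ there is at most one arrow $\beta$ with $\alpha\beta\notin I_{\mathcal G}$ and at most one $\gamma$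 with $\gamma\alpha\notin I_{\mathcal G}$), so each weakly connected component $N$ is either a chain $\omega_0\to\cdots\to\omega_n$ or an oriented cycle $\omega_0\to\cdots\to\omega_n\to\omega_0$, $n\ge 0$; $\omega(N):=\omega_0\cdots\omega_n$, determined up to rotation in the cycle case (any choice may be fixed). *)

theory Defs
  imports
    "Graph_Theory.Graph_Theory"
    "HOL-Algebra.Ideal"
    "HOL-Combinatorics.Orbits"
    "HOL-Computational_Algebra.Polynomial"
    "HOL-Library.Sublist"
begin

section \<open>Path algebras of quivers\<close>

text \<open>
  A quiver is a \<^type>\<open>pre_digraph\<close>. A path is a pair of its starting vertex and its list of arrows
  (so that the trivial path at \<open>u\<close> is \<open>(u, [])\<close>), and arrows are composed from left to right.
\<close>

definition paths :: "('q,'a) pre_digraph \<Rightarrow> ('q \<times> 'a list) set" where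
  "paths Q = {(u, p). \<exists>v. pre_digraph.awalk Q u p v}"

text \<open>
  Elements of the path algebra are finitely supported functions from paths to the coefficient
  field. The factorisations of a path \<open>(u, p)\<close> into two paths are given by the ways of splitting
  the list \<open>p\<close>, so the sum below is the bilinear extension of concatenation.
\<close>

definition path_algebra :: "('q,'a) pre_digraph \<Rightarrow> ('q \<times> 'a list \<Rightarrow> 'k::field) ring" where
  "path_algebra Q =
    \<lparr> carrier = {f. finite {p. f p \<noteq> 0} \<and> {p. f p \<noteq> 0} \<subseteq> paths Q},
      mult = (\<lambda>f g (u, p). \<Sum>k\<le>length p.
        f (u, take k p) * g (last (pre_digraph.awalk_verts Q u (take k p)), drop k p)),
      one = (\<lambda>(u, p). of_bool (u \<in> verts Q \<and> p = [])),
      zero = (\<lambda>_. 0),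
      add = (\<lambda>f g p. f p + g p) \<rparr>"

text \<open>The basis element given by a non-trivial path.\<close>

definition path_elem :: "('q,'a) pre_digraph \<Rightarrow> 'a list \<Rightarrow> 'q \<times> 'a list \<Rightarrow> 'k::field" where
  "path_elem Q w = (\<lambda>p. of_bool (p = (tail Q (hd w), w)))"


section \<open>Brauer graphs\<close>

text \<open>
  The field \<open>underlying\<close> is the undirected multigraph \<open>(V, E)\<close>; the library's digraphs are used only to
  record the two ends of every edge, and the orientation of the edges plays no role. The two
  half-edges of an edge \<open>e\<close> are \<open>(e, False)\<close> and \<open>(e, True)\<close>, incident to the tail and to the head
  of \<open>e\<close>; in particular a loop contributes two half-edges to its vertex. The cyclic order at a
  non-truncated vertex \<open>v\<close> is given by its successor function \<open>succ_at \<G> v\<close>; the values of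
  \<open>succ_at\<close> at other arguments are irrelevant.
\<close>

type_synonym 'e half_edge = "'e \<times> bool"

record ('v,'e) brauer_graph =
  underlying :: "('v,'e) pre_digraph"
  multiplicity :: "'v \<Rightarrow> nat"
  succ_at :: "'v \<Rightarrow> 'e half_edge \<Rightarrow> 'e half_edge"

definition end_of :: "('v,'e) brauer_graph \<Rightarrow> 'e half_edge \<Rightarrow> 'v" where
  "end_of \<G> h = (if snd h then head (underlying \<G>) (fst h) else tail (underlying \<G>) (fst h))"

definition half_edges_at :: "('v,'e) brauer_graph \<Rightarrow> 'v \<Rightarrow> 'e half_edge set" where
  "half_edges_at \<G> v = {h. fst h \<in> arcs (underlying \<G>) \<and> end_of \<G> h = v}"

definition val :: "('v,'e) brauer_graph \<Rightarrow> 'v \<Rightarrow> nat" where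
  "val \<G> v = card (half_edges_at \<G> v)"

definition truncated :: "('v,'e) brauer_graph \<Rightarrow> 'v \<Rightarrow> bool" where
  "truncated \<G> v \<longleftrightarrow> val \<G> v * multiplicity \<G> v = 1"

definition nontruncated_verts :: "('v,'e) brauer_graph \<Rightarrow> 'v set" where
  "nontruncated_verts \<G> = {v \<in> verts (underlying \<G>). \<not> truncated \<G> v}"

definition is_brauer_graph :: "('v,'e) brauer_graph \<Rightarrow> bool" where
  "is_brauer_graph \<G> \<longleftrightarrow>
     fin_digraph (underlying \<G>) \<and> connected (underlying \<G>) \<and> arcs (underlying \<G>) \<noteq> {} \<and>
     (\<forall>v \<in> verts (underlying \<G>). multiplicity \<G> v > 0) \<and>
     (\<forall>v \<in> nontruncated_verts \<G>. cyclic_on (succ_at \<G> v) (half_edges_at \<G> v))"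


section \<open>Brauer graph algebras\<close>

text \<open>The arrow attached to a half-edge \<open>h\<close> at a non-truncated vertex is \<open>h\<close> itself.\<close>

definition brauer_quiver :: "('v,'e) brauer_graph \<Rightarrow> ('e, 'e half_edge) pre_digraph" where
  "brauer_quiver \<G> =
    \<lparr> verts = arcs (underlying \<G>),
      arcs = (\<Union>v \<in> nontruncated_verts \<G>. half_edges_at \<G> v),
      tail = fst,
      head = (\<lambda>h. fst (succ_at \<G> (end_of \<G> h) h)) \<rparr>"

definition special_cycle :: "('v,'e) brauer_graph \<Rightarrow> 'v \<Rightarrow> 'e half_edge \<Rightarrow> 'e half_edge list" where
  "special_cycle \<G> v h = map (\<lambda>k. (succ_at \<G> v ^^ k) h) [0..<val \<G> v]"

definition path_power :: "'a list \<Rightarrow> nat \<Rightarrow> 'a list" where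
  "path_power w n = concat (replicate n w)"

definition relations_I ::
    "('v,'e) brauer_graph \<Rightarrow> ('e \<times> 'e half_edge list \<Rightarrow> 'k::field) set" where
  "relations_I \<G> =
     {\<lambda>p. path_elem (brauer_quiver \<G>) (path_power (special_cycle \<G> v h) (multiplicity \<G> v)) p
          - path_elem (brauer_quiver \<G>) (path_power (special_cycle \<G> v' h') (multiplicity \<G> v')) p
      | v v' h h'. v \<in> nontruncated_verts \<G> \<and> v' \<in> nontruncated_verts \<G>
          \<and> h \<in> half_edges_at \<G> v \<and> h' \<in> half_edges_at \<G> v'
          \<and> fst h = fst h' \<and> h \<noteq> h'}"

definition relations_II ::
    "('v,'e) brauer_graph \<Rightarrow> ('e \<times> 'e half_edge list \<Rightarrow> 'k::field) set" where
  "relations_II \<G> =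
     {path_elem (brauer_quiver \<G>)
        (path_power (special_cycle \<G> v h) (multiplicity \<G> v) @ [hd (special_cycle \<G> v h)])
      | v h. v \<in> nontruncated_verts \<G> \<and> h \<in> half_edges_at \<G> v}"

definition relations_III ::
    "('v,'e) brauer_graph \<Rightarrow> ('e \<times> 'e half_edge list \<Rightarrow> 'k::field) set" where
  "relations_III \<G> =
     {path_elem (brauer_quiver \<G>) [a, b]
      | a b. a \<in> arcs (brauer_quiver \<G>) \<and> b \<in> arcs (brauer_quiver \<G>)
          \<and> head (brauer_quiver \<G>) a = tail (brauer_quiver \<G>) b
          \<and> \<not> (\<exists>v \<in> nontruncated_verts \<G>. \<exists>h \<in> half_edges_at \<G> v.
                 sublist [a, b] (special_cycle \<G> v h))
          \<and> \<not> (a = b \<and> (\<exists>v \<in> nontruncated_verts \<G>. a \<in> half_edges_at \<G> v \<and> val \<G> v = 1))}"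

definition brauer_ideal ::
    "('v,'e) brauer_graph \<Rightarrow> ('e \<times> 'e half_edge list \<Rightarrow> 'k::field) set" where
  "brauer_ideal \<G> =
     Idl\<^bsub>path_algebra (brauer_quiver \<G>)\<^esub> (relations_I \<G> \<union> relations_II \<G> \<union> relations_III \<G>)"


section \<open>The ramifications graph\<close>

text \<open>
  A closed path running exactly once through all the arrows of a cyclic quiver. The predicate
  \<^const>\<open>pre_digraph.cycle\<close> requires the vertices along the closed path to be pairwise distinct.
\<close>

definition full_cycle :: "('q,'a) pre_digraph \<Rightarrow> 'a list \<Rightarrow> bool" where
  "full_cycle Q w \<longleftrightarrow> pre_digraph.cycle Q w \<and> set w = arcs Q \<and> head Q ` set w = verts Q"

definition cyclic_quiver :: "('q,'a) pre_digraph \<Rightarrow> bool" where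
  "cyclic_quiver Q \<longleftrightarrow> (\<exists>w. full_cycle Q w)"

definition unramified_path :: "('q,'a) pre_digraph \<Rightarrow> 'a list \<Rightarrow> bool" where
  "unramified_path Q w \<longleftrightarrow>
     w \<noteq> [] \<and> (\<exists>u v. pre_digraph.awalk Q u w v) \<and>
     (\<forall>j. Suc j < length w \<longrightarrow>
        out_degree Q (head Q (w ! j)) = 1 \<and> in_degree Q (head Q (w ! j)) = 1)"

text \<open>
  In the cyclic case the choice of one rotation of the cycle does not depend on the arrow. In the
  other case \<open>a\<close> is a subpath of \<open>w\<close> iff it is one of its arrows.
\<close>

definition omega :: "('q,'a) pre_digraph \<Rightarrow> 'a \<Rightarrow> 'a list" where
  "omega Q a =
     (if cyclic_quiver Q then (SOME w. full_cycle Q w)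
      else (THE w. unramified_path Q w \<and> a \<in> set w \<and>
              (\<forall>w'. unramified_path Q w' \<and> a \<in> set w' \<longrightarrow> length w' \<le> length w)))"

definition ramifications_graph ::
    "('q,'a) pre_digraph \<Rightarrow> ('q \<times> 'a list \<Rightarrow> 'k::field) set
      \<Rightarrow> ('a list, 'a list \<times> 'a list) pre_digraph" where
  "ramifications_graph Q I = with_proj
    \<lparr> pverts = omega Q ` arcs Q,
      parcs = {(w, w'). w \<in> omega Q ` arcs Q \<and> w' \<in> omega Q ` arcs Q \<and> w \<noteq> w' \<and>
                head Q (last w) = tail Q (hd w') \<and> path_elem Q [last w, hd w'] \<notin> I} \<rparr>"

text \<open>\<^const>\<open>connected\<close> is weak connectedness and entails being non-empty.\<close>

definition weak_components :: "('a,'b) pre_digraph \<Rightarrow> ('a,'b) pre_digraph set" where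
  "weak_components G = {N. pre_digraph.max_subgraph G connected N}"

definition chain_of :: "('a, 'a \<times> 'a) pre_digraph \<Rightarrow> 'a list \<Rightarrow> bool" where
  "chain_of N ws \<longleftrightarrow>
     ws \<noteq> [] \<and> distinct ws \<and> verts N = set ws \<and> arcs N = set (zip ws (tl ws))"

definition oriented_cycle_of :: "('a, 'a \<times> 'a) pre_digraph \<Rightarrow> 'a list \<Rightarrow> bool" where
  "oriented_cycle_of N ws \<longleftrightarrow>
     ws \<noteq> [] \<and> distinct ws \<and> verts N = set ws \<and> arcs N = set (zip ws (rotate1 ws))"

text \<open>
  For a chain the enumeration is unique; for an oriented cycle an arbitrary rotation is fixed. The
  concatenation is the composition of the paths that are the vertices of the component.
\<close>

definition omega_component :: "('a list, 'a list \<times> 'a list) pre_digraph \<Rightarrow> 'a list" where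
  "omega_component N = concat (SOME ws. chain_of N ws \<or> oriented_cycle_of N ws)"


section \<open>Well-formedness\<close>

text \<open>
  The ideal \<^term>\<open>Idl\<^bsub>R\<^esub> S\<close> is the intersection of the ideals of \<open>R\<close> containing \<open>S\<close>, and an ideal is
  required to live in a ring. The facts below show that this is meaningful for \<^const>\<open>brauer_ideal\<close>:
  the path algebra of a quiver with finitely many vertices is a ring, and the relations belong to it.
\<close>

lemma awalk_verts_last_append:
  "last (pre_digraph.awalk_verts Q u (p @ q)) =
   last (pre_digraph.awalk_verts Q (last (pre_digraph.awalk_verts Q u p)) q)"
  by (simp add: pre_digraph.awalk_verts_conv)

lemma sum_split_assoc:
  fixes F :: "nat \<Rightarrow> nat \<Rightarrow> 'k::comm_monoid_add"
  shows "(\<Sum>k\<le>n. \<Sum>j\<le>k. F j k) = (\<Sum>j\<le>n. \<Sum>i\<le>n - j. F j (j + i))"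
proof -
  have "(\<Sum>k\<le>n. \<Sum>j\<le>k. F j k) = (\<Sum>(k, j) \<in> (SIGMA k:{..n}. {..k}). F j k)"
    by (subst sum.Sigma) auto
  also have "\<dots> = (\<Sum>(j, i) \<in> (SIGMA j:{..n}. {..n - j}). F j (j + i))"
    by (rule sum.reindex_bij_witness[where i = "\<lambda>(j, i). (j + i, j)" and j = "\<lambda>(k, j). (j, k - j)"])
      auto
  also have "\<dots> = (\<Sum>j\<le>n. \<Sum>i\<le>n - j. F j (j + i))"
    by (subst sum.Sigma) auto
  finally show ?thesis .
qed

lemma path_algebra_mult:
  "(f \<otimes>\<^bsub>path_algebra Q\<^esub> g) (u, p) =
     (\<Sum>k\<le>length p. f (u, take k p) * g (last (pre_digraph.awalk_verts Q u (take k p)), drop k p))"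
  by (simp add: path_algebra_def)

lemma paths_append:
  assumes "wf_digraph Q"
    and "(u, p) \<in> paths Q" "(last (pre_digraph.awalk_verts Q u p), q) \<in> paths Q"
  shows "(u, p @ q) \<in> paths Q"
proof -
  interpret wf_digraph Q by fact
  show ?thesis using assms(2,3) unfolding paths_def by auto
qed

lemma path_algebra_mult_closed:
  fixes f g :: "'q \<times> 'a list \<Rightarrow> 'k::field"
  assumes "wf_digraph Q"
    and "f \<in> carrier (path_algebra Q)" "g \<in> carrier (path_algebra Q)"
  shows "f \<otimes>\<^bsub>path_algebra Q\<^esub> g \<in> carrier (path_algebra Q)"
proof -
  let ?S = "{p. f p \<noteq> 0}" and ?T = "{p. g p \<noteq> 0}"
  let ?h = "f \<otimes>\<^bsub>path_algebra Q\<^esub> g"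
  have ex: "\<exists>k. (u, take k p) \<in> ?S
      \<and> (last (pre_digraph.awalk_verts Q u (take k p)), drop k p) \<in> ?T"
    if "?h (u, p) \<noteq> 0" for u p
  proof (rule ccontr)
    assume "\<not> ?thesis"
    then have "?h (u, p) = 0" unfolding path_algebra_mult by (intro sum.neutral) auto
    with that show False ..
  qed
  have "{p. ?h p \<noteq> 0} \<subseteq> (\<lambda>((u, p), (v, q)). (u, p @ q)) ` (?S \<times> ?T)"
  proof
    fix x assume "x \<in> {p. ?h p \<noteq> 0}"
    then obtain u p where x: "x = (u, p)" and "?h (u, p) \<noteq> 0" by (cases x) auto
    from ex[OF this(2)] obtain k where k: "(u, take k p) \<in> ?S"
      "(last (pre_digraph.awalk_verts Q u (take k p)), drop k p) \<in> ?T" by blast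
    show "x \<in> (\<lambda>((u, p), (v, q)). (u, p @ q)) ` (?S \<times> ?T)"
      by (rule image_eqI[OF _ SigmaI[OF k]]) (simp add: x)
  qed
  moreover have "finite (?S \<times> ?T)"
    using assms(2,3) by (simp add: path_algebra_def)
  ultimately have "finite {p. ?h p \<noteq> 0}"
    by (meson finite_imageI finite_subset)
  moreover have "{p. ?h p \<noteq> 0} \<subseteq> paths Q"
  proof
    fix x assume "x \<in> {p. ?h p \<noteq> 0}"
    then obtain u p where x: "x = (u, p)" and "?h (u, p) \<noteq> 0" by (cases x) auto
    from ex[OF this(2)] obtain k where "(u, take k p) \<in> paths Q"
      "(last (pre_digraph.awalk_verts Q u (take k p)), drop k p) \<in> paths Q"
      using assms by (auto simp: path_algebra_def)
    from paths_append[OF assms(1) this] show "x \<in> paths Q" by (simp add: x)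
  qed
  ultimately show ?thesis by (simp add: path_algebra_def)
qed

lemma path_algebra_mult_assoc:
  fixes f g h :: "'q \<times> 'a list \<Rightarrow> 'k::field"
  shows "(f \<otimes>\<^bsub>path_algebra Q\<^esub> g) \<otimes>\<^bsub>path_algebra Q\<^esub> h =
    f \<otimes>\<^bsub>path_algebra Q\<^esub> (g \<otimes>\<^bsub>path_algebra Q\<^esub> h)"
proof (rule ext, clarify)
  fix u p
  let ?e = "\<lambda>k. last (pre_digraph.awalk_verts Q u (take k p))"
  let ?F = "\<lambda>j k. f (u, take j p) * g (?e j, drop j (take k p)) * h (?e k, drop k p)"
  have "((f \<otimes>\<^bsub>path_algebra Q\<^esub> g) \<otimes>\<^bsub>path_algebra Q\<^esub> h) (u, p) = (\<Sum>k\<le>length p. \<Sum>j\<le>k. ?F j k)"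
    unfolding path_algebra_mult by (auto simp: sum_distrib_right min_def intro!: sum.cong)
  also have "\<dots> = (\<Sum>j\<le>length p. \<Sum>i\<le>length p - j. ?F j (j + i))"
    by (rule sum_split_assoc)
  also have "\<dots> = (f \<otimes>\<^bsub>path_algebra Q\<^esub> (g \<otimes>\<^bsub>path_algebra Q\<^esub> h)) (u, p)"
  proof -
    have *: "?e (j + i) = last (pre_digraph.awalk_verts Q (?e j) (take i (drop j p)))" for i j
      by (simp add: take_add awalk_verts_last_append)
    show ?thesis
      unfolding path_algebra_mult *
      by (auto simp: sum_distrib_left mult.assoc drop_take add.commute intro!: sum.cong)
  qed
  finally show "((f \<otimes>\<^bsub>path_algebra Q\<^esub> g) \<otimes>\<^bsub>path_algebra Q\<^esub> h) (u, p) =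
    (f \<otimes>\<^bsub>path_algebra Q\<^esub> (g \<otimes>\<^bsub>path_algebra Q\<^esub> h)) (u, p)" .
qed

theorem ring_path_algebra:
  assumes "wf_digraph Q" "finite (verts Q)"
  shows "ring (path_algebra Q :: ('q \<times> 'a list \<Rightarrow> 'k::field) ring)" (is "ring ?R")
proof (rule ringI)
  interpret wf_digraph Q by fact
  have carr: "x \<in> carrier ?R \<longleftrightarrow> finite {p. x p \<noteq> 0} \<and> {p. x p \<noteq> 0} \<subseteq> paths Q" for x
    by (simp add: path_algebra_def)
  have add: "x \<oplus>\<^bsub>?R\<^esub> y = (\<lambda>p. x p + y p)" for x y by (simp add: path_algebra_def)
  have zero: "\<zero>\<^bsub>?R\<^esub> = (\<lambda>_. 0)" by (simp add: path_algebra_def)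
  have one: "\<one>\<^bsub>?R\<^esub> = (\<lambda>(u, p). of_bool (u \<in> verts Q \<and> p = []))" by (simp add: path_algebra_def)
  have one_carr: "\<one>\<^bsub>?R\<^esub> \<in> carrier ?R"
  proof -
    have "{p. \<one>\<^bsub>?R\<^esub> p \<noteq> (0::'k)} = (\<lambda>u. (u, [])) ` verts Q" by (auto simp: one)
    then show ?thesis using assms(2) by (auto simp: carr paths_def awalk_Nil_iff)
  qed
  show "abelian_group ?R"
  proof (rule abelian_groupI)
    fix x y assume "x \<in> carrier ?R" "y \<in> carrier ?R"
    moreover have "{p. x p + y p \<noteq> 0} \<subseteq> {p. x p \<noteq> 0} \<union> {p. y p \<noteq> 0}" by auto
    ultimately show "x \<oplus>\<^bsub>?R\<^esub> y \<in> carrier ?R"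
      unfolding carr add by (meson Un_least finite_Un finite_subset order_trans)
  next
    fix x assume "x \<in> carrier ?R"
    then show "\<exists>y\<in>carrier ?R. y \<oplus>\<^bsub>?R\<^esub> x = \<zero>\<^bsub>?R\<^esub>"
      by (intro bexI[of _ "\<lambda>p. - x p"]) (auto simp: carr add zero)
  qed (auto simp: carr add zero algebra_simps)
  show "Group.monoid ?R"
  proof (rule monoidI)
    fix x y z assume x: "x \<in> carrier ?R"
    show "x \<otimes>\<^bsub>?R\<^esub> y \<otimes>\<^bsub>?R\<^esub> z = x \<otimes>\<^bsub>?R\<^esub> (y \<otimes>\<^bsub>?R\<^esub> z)" by (rule path_algebra_mult_assoc)
    have supp: "x (u, p) = 0" if "u \<notin> verts Q" for u p
      using x that by (auto simp: carr paths_def awalk_def)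
    have supp': "x (u, p) = 0" if "last (pre_digraph.awalk_verts Q u p) \<notin> verts Q" for u p
    proof (rule ccontr)
      assume "x (u, p) \<noteq> 0"
      then obtain v where "awalk u p v" using x unfolding carr paths_def by blast
      then show False using that by (auto simp: awalk_def awlast_in_verts)
    qed
    show "\<one>\<^bsub>?R\<^esub> \<otimes>\<^bsub>?R\<^esub> x = x"
    proof (rule ext, clarify)
      fix u p
      have "(\<one>\<^bsub>?R\<^esub> \<otimes>\<^bsub>?R\<^esub> x) (u, p) = (\<Sum>k\<le>length p. if k = 0 then of_bool (u \<in> verts Q) * x (u, p) else 0)"
        unfolding path_algebra_mult one by (rule sum.cong) auto
      also have "\<dots> = x (u, p)" using supp by (cases "u \<in> verts Q") auto
      finally show "(\<one>\<^bsub>?R\<^esub> \<otimes>\<^bsub>?R\<^esub> x) (u, p) = x (u, p)" .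
    qed
    show "x \<otimes>\<^bsub>?R\<^esub> \<one>\<^bsub>?R\<^esub> = x"
    proof (rule ext, clarify)
      fix u p
      have "(x \<otimes>\<^bsub>?R\<^esub> \<one>\<^bsub>?R\<^esub>) (u, p) = (\<Sum>k\<le>length p. if k = length p
          then x (u, p) * of_bool (last (pre_digraph.awalk_verts Q u p) \<in> verts Q) else 0)"
        unfolding path_algebra_mult one by (rule sum.cong) auto
      also have "\<dots> = x (u, p)" using supp' by (simp add: of_bool_def)
      finally show "(x \<otimes>\<^bsub>?R\<^esub> \<one>\<^bsub>?R\<^esub>) (u, p) = x (u, p)" .
    qed
  qed (use path_algebra_mult_closed assms(1) one_carr in auto)
qed (auto simp: path_algebra_def fun_eq_iff algebra_simps sum.distrib)

lemma cyclic_on_funpow_card: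
  assumes "cyclic_on f S" "x \<in> S"
  shows "(f ^^ card S) x = x"
proof -
  have S: "S = orbit f x" using assms by (auto simp: cyclic_on_alldef)
  then have x: "x \<in> orbit f x" using assms by simp
  have "card S = funpow_dist1 f x x"
    unfolding S by (subst orbit_conv_funpow_dist1[OF x]) (simp add: card_image inj_on_funpow_dist1[OF x])
  then show ?thesis using funpow_dist1_prop[OF x] by simp
qed

lemma fin_digraph_brauer_quiver:
  assumes "is_brauer_graph \<G>"
  shows "fin_digraph (brauer_quiver \<G>)"
proof -
  interpret fin_digraph "underlying \<G>" using assms by (simp add: is_brauer_graph_def)
  have cyc: "cyclic_on (succ_at \<G> v) (half_edges_at \<G> v)" if "v \<in> nontruncated_verts \<G>" for v
    using assms that by (simp add: is_brauer_graph_def)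
  show ?thesis
  proof
    fix h assume h: "h \<in> arcs (brauer_quiver \<G>)"
    then obtain v where v: "v \<in> nontruncated_verts \<G>" "h \<in> half_edges_at \<G> v"
      by (auto simp: brauer_quiver_def)
    then show "tail (brauer_quiver \<G>) h \<in> verts (brauer_quiver \<G>)"
      by (simp add: brauer_quiver_def half_edges_at_def)
    show "head (brauer_quiver \<G>) h \<in> verts (brauer_quiver \<G>)"
      using cyclic_on_inI[OF cyc[OF v(1)] v(2)] v(2)
      by (simp add: brauer_quiver_def half_edges_at_def)
  next
    show "finite (verts (brauer_quiver \<G>))" by (simp add: brauer_quiver_def)
    have "arcs (brauer_quiver \<G>) \<subseteq> arcs (underlying \<G>) \<times> UNIV"
      by (auto simp: brauer_quiver_def half_edges_at_def)
    then show "finite (arcs (brauer_quiver \<G>))"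
      by (rule finite_subset) simp
  qed
qed

lemma special_cycle_awalk:
  assumes "is_brauer_graph \<G>" "v \<in> nontruncated_verts \<G>" "h \<in> half_edges_at \<G> v"
  shows "pre_digraph.awalk (brauer_quiver \<G>) (fst h) (special_cycle \<G> v h) (fst h)"
proof -
  interpret wf_digraph "brauer_quiver \<G>"
    using fin_digraph_brauer_quiver[OF assms(1)] by (simp add: fin_digraph_def)
  have cyc: "cyclic_on (succ_at \<G> v) (half_edges_at \<G> v)"
    using assms by (simp add: is_brauer_graph_def)
  have H: "(succ_at \<G> v ^^ k) h \<in> half_edges_at \<G> v" for k
    using cyc assms(3) by (rule cyclic_on_funpow_in)
  then have A: "(succ_at \<G> v ^^ k) h \<in> arcs (brauer_quiver \<G>)" for k
    using assms(2) by (auto simp: brauer_quiver_def)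
  have "awalk (fst h) (map (\<lambda>k. (succ_at \<G> v ^^ k) h) [0..<n]) (fst ((succ_at \<G> v ^^ n) h))" for n
  proof (induction n)
    case 0
    then show ?case
      using assms(3) unfolding upt_0 list.map funpow_0
      by (subst awalk_Nil_iff) (simp add: brauer_quiver_def half_edges_at_def)
  next
    case (Suc n)
    let ?a = "(succ_at \<G> v ^^ n) h"
    have "awalk (fst ?a) [?a] (fst ((succ_at \<G> v ^^ Suc n) h))"
      using A[of n] H[of n] tail_in_verts[OF A[of n]] unfolding awalk_def
      by (simp add: brauer_quiver_def half_edges_at_def pre_digraph.cas.simps)
    with Suc show ?case by (auto simp del: funpow.simps)
  qed
  from this[of "val \<G> v"] show ?thesis
    unfolding special_cycle_def val_def cyclic_on_funpow_card[OF cyc assms(3)] .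
qed

lemma path_elem_carrier:
  assumes "pre_digraph.awalk Q u w v" "w \<noteq> []"
  shows "path_elem Q w \<in> carrier (path_algebra Q)"
proof -
  have "tail Q (hd w) = u"
    using assms by (cases w) (auto simp: pre_digraph.awalk_def pre_digraph.cas.simps)
  with assms show ?thesis by (auto simp: path_elem_def path_algebra_def paths_def)
qed

theorem relations_carrier:
  assumes "is_brauer_graph \<G>"
  shows "relations_I \<G> \<union> relations_II \<G> \<union> relations_III \<G>
    \<subseteq> carrier (path_algebra (brauer_quiver \<G>) :: ('e \<times> 'e half_edge list \<Rightarrow> 'k::field) ring)"
proof -
  let ?Q = "brauer_quiver \<G>"
  let ?A = "path_algebra ?Q :: ('e \<times> 'e half_edge list \<Rightarrow> 'k) ring"
  interpret fin_digraph ?Q using assms by (rule fin_digraph_brauer_quiver)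
  have ne: "special_cycle \<G> v h \<noteq> []" if "h \<in> half_edges_at \<G> v" for v h
  proof -
    have "half_edges_at \<G> v \<subseteq> arcs (underlying \<G>) \<times> UNIV" by (auto simp: half_edges_at_def)
    moreover have "finite (arcs (underlying \<G>))"
      using assms by (simp add: is_brauer_graph_def fin_digraph.finite_arcs)
    ultimately have "finite (half_edges_at \<G> v)" by (meson finite_SigmaI finite_subset finite)
    then show ?thesis using that by (auto simp: special_cycle_def val_def card_eq_0_iff)
  qed
  have pow: "awalk (fst h) (path_power (special_cycle \<G> v h) n) (fst h)"
    if "v \<in> nontruncated_verts \<G>" "h \<in> half_edges_at \<G> v" for v h n
  proof (induction n)
    case 0
    then show ?case using that unfolding path_power_def replicate_0 concat.simps
      by (subst awalk_Nil_iff) (simp add: brauer_quiver_def half_edges_at_def)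
  next
    case (Suc n)
    then show ?case
      using special_cycle_awalk[OF assms that] by (auto simp: path_power_def)
  qed
  have pos: "multiplicity \<G> v > 0" if "v \<in> nontruncated_verts \<G>" for v
    using assms that by (simp add: is_brauer_graph_def nontruncated_verts_def)
  have pow_ne: "path_power (special_cycle \<G> v h) (multiplicity \<G> v) \<noteq> []"
    if "v \<in> nontruncated_verts \<G>" "h \<in> half_edges_at \<G> v" for v h
    using ne[OF that(2)] pos[OF that(1)] by (auto simp: path_power_def)
  have "relations_I \<G> \<subseteq> carrier ?A"
  proof
    fix r :: "'e \<times> 'e half_edge list \<Rightarrow> 'k" assume "r \<in> relations_I \<G>"
    then obtain v v' h h' where vh: "v \<in> nontruncated_verts \<G>" "h \<in> half_edges_at \<G> v"
      "v' \<in> nontruncated_verts \<G>" "h' \<in> half_edges_at \<G> v'"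
      and r: "r = (\<lambda>p. path_elem ?Q (path_power (special_cycle \<G> v h) (multiplicity \<G> v)) p
          - path_elem ?Q (path_power (special_cycle \<G> v' h') (multiplicity \<G> v')) p)"
        (is "r = (\<lambda>p. ?x p - ?y p)")
      unfolding relations_I_def by blast
    have "?x \<in> carrier ?A" "?y \<in> carrier ?A"
      using vh by (auto intro!: path_elem_carrier[OF pow pow_ne])
    moreover have "{p. r p \<noteq> 0} \<subseteq> {p. ?x p \<noteq> 0} \<union> {p. ?y p \<noteq> 0}" by (auto simp: r)
    ultimately show "r \<in> carrier ?A"
      by (simp add: path_algebra_def) (meson Un_least finite_Un finite_subset order_trans)
  qed
  moreover have "relations_II \<G> \<subseteq> carrier ?A"
  proof
    fix r :: "'e \<times> 'e half_edge list \<Rightarrow> 'k" assume "r \<in> relations_II \<G>"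
    then obtain v h where vh: "v \<in> nontruncated_verts \<G>" "h \<in> half_edges_at \<G> v"
      and r: "r = path_elem ?Q
        (path_power (special_cycle \<G> v h) (multiplicity \<G> v) @ [hd (special_cycle \<G> v h)])"
      unfolding relations_II_def by blast
    from special_cycle_awalk[OF assms vh] ne[OF vh(2)]
    have "awalk (fst h) [hd (special_cycle \<G> v h)] (head ?Q (hd (special_cycle \<G> v h)))"
      by (cases "special_cycle \<G> v h") (auto simp: awalk_def)
    with pow[OF vh] have "awalk (fst h)
        (path_power (special_cycle \<G> v h) (multiplicity \<G> v) @ [hd (special_cycle \<G> v h)])
        (head ?Q (hd (special_cycle \<G> v h)))"
      by (metis awalk_appendI)
    then show "r \<in> carrier ?A" unfolding r by (rule path_elem_carrier) simp
  qed
  moreover have "relations_III \<G> \<subseteq> carrier ?A"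
  proof
    fix r :: "'e \<times> 'e half_edge list \<Rightarrow> 'k" assume "r \<in> relations_III \<G>"
    then obtain a b where ab: "a \<in> arcs ?Q" "b \<in> arcs ?Q" "head ?Q a = tail ?Q b"
      and r: "r = path_elem ?Q [a, b]"
      unfolding relations_III_def by blast
    then have "awalk (tail ?Q a) [a, b] (head ?Q b)" by (simp add: awalk_def)
    then show "r \<in> carrier ?A" unfolding r by (rule path_elem_carrier) simp
  qed
  ultimately show ?thesis by simp
qed

end

theory Submission
  imports Defs
begin

text \<open>
  For composable arrows \<open>a\<close> and \<open>b\<close> the product \<open>ab\<close> lies in the ideal iff \<open>b\<close> is not the successor
  of \<open>a\<close> in the cyclic order. Relations (III) give one direction; for the other, the functions on
  paths that vanish on the proper subpaths of the full turns \<open>A\<^sup>m\<close> based at the edge of \<open>a\<close>, and whose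
  values at these full turns sum to zero, form an ideal that contains all relations but not the
  product of \<open>a\<close> and its successor.

  A half-edge is ramified if the other half of its edge is an arrow too. Every vertex of the quiver
  has equal in- and out-degree, which is 1 exactly at the edges of unramified half-edges. Hence,
  unless the quiver is cyclic, the paths \<open>\<omega>\<^sub>a\<close> are the segments into which the ramified half-edges cut
  the cyclic orders, and by the first paragraph the ramifications graph links each segment to the
  next one at the same vertex. The only obstruction would be a non-truncated vertex without
  ramified half-edges, but then the Brauer graph is a star and the quiver is cyclic.
\<close>

section \<open>Iterates of a function\<close>

lemma funpow_funpow: "(f ^^ m) ((f ^^ n) x) = (f ^^ (m + n)) x"
  by (simp add: funpow_add)

definition iterates :: "('a \<Rightarrow> 'a) \<Rightarrow> 'a \<Rightarrow> nat \<Rightarrow> 'a list" where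
  "iterates f x n = map (\<lambda>k. (f ^^ k) x) [0..<n]"

lemma length_iterates [simp]: "length (iterates f x n) = n"
  by (simp add: iterates_def)

lemma nth_iterates [simp]: "i < n \<Longrightarrow> iterates f x n ! i = (f ^^ i) x"
  by (simp add: iterates_def)

lemma iterates_eq_Nil_iff [simp]: "iterates f x n = [] \<longleftrightarrow> n = 0"
  by (simp add: iterates_def)

lemma hd_iterates: "0 < n \<Longrightarrow> hd (iterates f x n) = x"
  by (simp add: hd_conv_nth)

lemma last_iterates: "0 < n \<Longrightarrow> last (iterates f x n) = (f ^^ (n - 1)) x"
  by (simp add: last_conv_nth)

lemma set_iterates: "set (iterates f x n) = (\<lambda>k. (f ^^ k) x) ` {..<n}"
  by (auto simp: iterates_def)

lemma iterates_add: "iterates f x (m + n) = iterates f x m @ iterates f ((f ^^ m) x) n"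
  by (rule nth_equalityI)
    (auto simp: nth_append funpow_funpow)

lemma successively_iterates: "successively (\<lambda>x y. y = f x) (iterates f x n)"
  by (simp add: successively_conv_nth)

lemma successively_nth_funpow:
  assumes "successively (\<lambda>x y. y = f x) xs" "i + j < length xs"
  shows "xs ! (i + j) = (f ^^ j) (xs ! i)"
  using assms(2)
proof (induction j)
  case (Suc j)
  then show ?case using successively_nth[OF assms(1), of "i + j"] by simp
qed simp

lemma successively_eq_iterates:
  assumes "successively (\<lambda>x y. y = f x) xs" "xs \<noteq> []"
  shows "xs = iterates f (hd xs) (length xs)"
proof (rule nth_equalityI)
  fix i assume "i < length xs"
  then show "xs ! i = iterates f (hd xs) (length xs) ! i"
    using successively_nth_funpow[OF assms(1), of 0 i] assms(2) by (simp add: hd_conv_nth)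
qed simp

lemma successively_sublist:
  "successively P ys \<Longrightarrow> sublist xs ys \<Longrightarrow> successively P xs"
  by (auto simp: sublist_def successively_append_iff)

text \<open>Each element of \<open>S\<close> lies on its own orbit and so is the image of one of its
  iterates. Hence \<open>f\<close> maps the finite set \<open>S\<close> onto itself, which makes it
  injective.\<close>

lemma cyclic_on_inj_on:
  assumes "cyclic_on f S" "finite S"
  shows "inj_on f S"
proof -
  have "f ` S = S"
  proof
    show "f ` S \<subseteq> S" using assms(1) by (auto intro: cyclic_on_inI)
    show "S \<subseteq> f ` S"
    proof
      fix x assume x: "x \<in> S"
      then have "S = orbit f x" using assms(1) by (auto simp: cyclic_on_alldef)
      with x have "x \<in> orbit f x" by blast
      then obtain n where n: "0 < n" "x = (f ^^ n) x" by (auto simp: orbit_altdef)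
      then have "x = f ((f ^^ (n - 1)) x)" by (metis Suc_diff_1 funpow.simps(2) comp_apply)
      then show "x \<in> f ` S" using cyclic_on_funpow_in[OF assms(1) x, of "n - 1"] by blast
    qed
  qed
  then have "S \<subseteq> f ` S" by blast
  with assms(2) show ?thesis by (rule finite_surj_inj)
qed

text \<open>The orbit of \<open>x\<close> is all of \<open>S\<close>, so its first return time is
  \<open>card S\<close>. The list has as many entries as \<open>S\<close> has elements, which rules
  out repetitions.\<close>

lemma iterates_cyclic_on:
  assumes "cyclic_on f S" "finite S" "x \<in> S"
  shows "set (iterates f x (card S)) = S" "distinct (iterates f x (card S))"
proof -
  have S: "S = orbit f x" using assms by (auto simp: cyclic_on_alldef)
  then have x: "x \<in> orbit f x" using assms(3) by blast
  have image: "S = (\<lambda>k. (f ^^ k) x) ` {..<funpow_dist1 f x x}"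
    unfolding atLeast0LessThan[symmetric] orbit_conv_funpow_dist1[OF x, symmetric] by (rule S)
  have "card S = funpow_dist1 f x x"
    by (subst image, subst card_image) (simp_all only: inj_on_funpow_dist1[OF x] atLeast0LessThan[symmetric] card_atLeastLessThan diff_zero)
  then show set: "set (iterates f x (card S)) = S"
    by (simp only: set_iterates image[symmetric])
  then show "distinct (iterates f x (card S))"
    by (intro card_distinct) (simp only: set length_iterates)
qed

section \<open>Directed graphs and lists\<close>

text \<open>Trades end points for a condition on consecutive arcs, so that walks can be handled as
  plain lists.\<close>

lemma (in wf_digraph) ex_awalk_iff:
  "p \<noteq> [] \<Longrightarrow> (\<exists>u v. awalk u p v) \<longleftrightarrow> set p \<subseteq> arcs G \<and> successively (\<lambda>a b. head G a = tail G b) p"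
proof (induction p)
  case (Cons a p)
  show ?case
  proof (cases p)
    case Nil
    then show ?thesis by (auto simp: awalk_Cons_iff awalk_Nil_iff)
  next
    case (Cons b q)
    then have "(\<exists>u v. awalk u (a # p) v) \<longleftrightarrow>
        a \<in> arcs G \<and> head G a = tail G b \<and> (\<exists>u v. awalk u p v)"
      by (auto simp: awalk_Cons_iff)
    then show ?thesis using Cons.IH Cons by auto
  qed
qed simp

lemma successively_concat:
  assumes "\<And>w. w \<in> set ws \<Longrightarrow> w \<noteq> [] \<and> successively P w"
    and "successively (\<lambda>v w. P (last v) (hd w)) ws"
  shows "successively P (concat ws)"
  using assms
proof (induction ws)
  case (Cons w ws)
  then have "successively P (concat ws)" by (auto simp: successively_Cons)
  moreover have "concat ws = [] \<or> P (last w) (hd (concat ws))"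
    using Cons.prems by (cases ws) (auto simp: successively_Cons)
  ultimately show ?case using Cons.prems(1)[of w] by (auto simp: successively_append_iff)
qed simp

text \<open>Once the orbit closes up, shifting the list cyclically and applying \<open>f\<close>
  agree. With \<open>set_zip_map\<close> this identifies the arcs of an oriented cycle with the
  graph of \<open>f\<close>.\<close>

lemma rotate1_iterates:
  assumes "(f ^^ n) x = x"
  shows "rotate1 (iterates f x n) = map f (iterates f x n)"
proof (rule nth_equalityI)
  fix i assume "i < length (rotate1 (iterates f x n))"
  then have i: "i < n" by simp
  show "rotate1 (iterates f x n) ! i = map f (iterates f x n) ! i"
  proof (cases "Suc i = n")
    case True
    then have "(f ^^ n) x = f ((f ^^ i) x)" by auto
    then show ?thesis using i True assms by (simp add: nth_rotate1)
  next
    case False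
    then show ?thesis using i by (simp add: nth_rotate1)
  qed
qed simp

lemma set_zip_map: "set (zip xs (map f xs)) = (\<lambda>x. (x, f x)) ` set xs"
  by (induction xs) auto

text \<open>The equivalence lets \<open>P\<close> travel along arcs in both directions, hence along
  walks of the symmetrised graph.\<close>

lemma connected_invariant:
  assumes "connected G" and step: "\<And>a. a \<in> arcs G \<Longrightarrow> P (tail G a) \<longleftrightarrow> P (head G a)"
    and "x \<in> verts G" "y \<in> verts G" "P x"
  shows "P y"
proof -
  have "x \<rightarrow>\<^sup>*\<^bsub>with_proj (mk_symmetric G)\<^esub> y"
    using assms(1,3,4) by (auto simp: connected_def strongly_connected_def)
  then have "(x, y) \<in> (parcs (mk_symmetric G))\<^sup>*"
    using reachable_rtranclI[of "with_proj (mk_symmetric G)"] by simp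
  then show ?thesis
    by (induction rule: rtrancl_induct) (use assms(5) step in \<open>auto simp: parcs_mk_symmetric\<close>)
qed

lemma (in wf_digraph) strongly_connected_imp_connected:
  assumes "strongly_connected G"
  shows "connected G"
  using assms reachable_mk_symmetricI by (auto simp: connected_def strongly_connected_def)

section \<open>Separating a path from the ideal\<close>

text \<open>
  Functions in this set kill all proper subpaths of the given closed paths, so that in a product
  only the two extreme splittings of each of these paths survive.
\<close>

definition vanishing_ideal ::
    "('q,'a) pre_digraph \<Rightarrow> 'q \<Rightarrow> 'a list set \<Rightarrow> ('q \<times> 'a list \<Rightarrow> 'k::field) set" where
  "vanishing_ideal Q e C = {f \<in> carrier (path_algebra Q).
     (\<forall>p\<in>C. \<forall>q u. sublist q p \<longrightarrow> q \<noteq> p \<longrightarrow> f (u, q) = 0) \<and> (\<Sum>p\<in>C. f (e, p)) = 0}"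

text \<open>In a product at a proper subpath of some \<open>p\<close> in \<open>C\<close>, every
  splitting evaluates the factor from the set at a proper subpath again, so all terms vanish. At
  \<open>p\<close> itself only the splitting with a trivial cofactor survives; as all of
  \<open>C\<close> is closed at \<open>e\<close>, the sum over \<open>C\<close> is multiplied by a
  single scalar.\<close>

lemma ideal_vanishing_ideal:
  fixes Q :: "('q,'a) pre_digraph"
  assumes "fin_digraph Q" and closed: "\<And>p. p \<in> C \<Longrightarrow> pre_digraph.awalk Q e p e"
  shows "ideal (vanishing_ideal Q e C :: ('q \<times> 'a list \<Rightarrow> 'k::field) set) (path_algebra Q)"
    (is "ideal ?J ?A")
proof -
  interpret fin_digraph Q by fact
  interpret A: ring ?A by (rule ring_path_algebra) (auto intro: wf_digraph)
  have add: "x \<oplus>\<^bsub>?A\<^esub> y = (\<lambda>p. x p + y p)" for x y :: "'q \<times> 'a list \<Rightarrow> 'k"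
    by (simp add: path_algebra_def)
  have zero: "\<zero>\<^bsub>?A\<^esub> = (\<lambda>_. 0 :: 'k)" by (simp add: path_algebra_def)
  have sub: "sublist (take k q) p" "sublist (drop k q) p" if "sublist q p" for k and q p :: "'a list"
    using that by (meson sublist_order.order.trans sublist_take sublist_drop)+
  have left: "x \<otimes>\<^bsub>?A\<^esub> f \<in> ?J" if f: "f \<in> ?J" and x: "x \<in> carrier ?A" for f x
  proof -
    have "(x \<otimes>\<^bsub>?A\<^esub> f) (u, q) = 0" if "p \<in> C" "sublist q p" "q \<noteq> p" for p q u
    proof -
      have "f (v, drop k q) = 0" for v k
      proof -
        have "drop k q \<noteq> p" using that(2,3) by (metis sublist_drop sublist_order.order.antisym)
        then show ?thesis using f that(1) sub(2)[OF that(2), of k] by (auto simp: vanishing_ideal_def)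
      qed
      then show ?thesis by (simp add: path_algebra_mult)
    qed
    moreover have "(x \<otimes>\<^bsub>?A\<^esub> f) (e, p) = x (e, []) * f (e, p)" if "p \<in> C" for p
    proof -
      have "f (v, drop k p) = 0" if "0 < k" "k \<le> length p" for v k
      proof -
        have "drop k p \<noteq> p" using that by (metis diff_less length_drop less_le_trans nat_less_le)
        then show ?thesis using f \<open>p \<in> C\<close> unfolding vanishing_ideal_def by auto
      qed
      then have "(x \<otimes>\<^bsub>?A\<^esub> f) (e, p) =
          (\<Sum>k\<le>length p. if k = 0 then x (e, []) * f (e, p) else 0)"
        unfolding path_algebra_mult by (intro sum.cong) auto
      then show ?thesis by simp
    qed
    moreover have "x \<otimes>\<^bsub>?A\<^esub> f \<in> carrier ?A"
      using f x by (simp add: vanishing_ideal_def)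
    ultimately show ?thesis
      using f by (simp add: vanishing_ideal_def sum_distrib_left[symmetric])
  qed
  have right: "f \<otimes>\<^bsub>?A\<^esub> x \<in> ?J" if f: "f \<in> ?J" and x: "x \<in> carrier ?A" for f x
  proof -
    have "(f \<otimes>\<^bsub>?A\<^esub> x) (u, q) = 0" if "p \<in> C" "sublist q p" "q \<noteq> p" for p q u
    proof -
      have "f (v, take k q) = 0" for v k
      proof -
        have "take k q \<noteq> p" using that(2,3) by (metis sublist_take sublist_order.order.antisym)
        then show ?thesis using f that(1) sub(1)[OF that(2), of k] by (auto simp: vanishing_ideal_def)
      qed
      then show ?thesis by (simp add: path_algebra_mult)
    qed
    moreover have "(f \<otimes>\<^bsub>?A\<^esub> x) (e, p) = f (e, p) * x (e, [])" if "p \<in> C" for p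
    proof -
      have "f (v, take k p) = 0" if "k < length p" for v k
      proof -
        have "take k p \<noteq> p" using that by (metis length_take min_less_iff_conj nat_less_le)
        then show ?thesis using f \<open>p \<in> C\<close> unfolding vanishing_ideal_def by auto
      qed
      \<comment> \<open>The cofactor sits at the end of \<open>p\<close>, which is \<open>e\<close>
        again because \<open>p\<close> is closed.\<close>
      then have "(f \<otimes>\<^bsub>?A\<^esub> x) (e, p) =
          (\<Sum>k\<le>length p. if k = length p then f (e, p) * x (e, []) else 0)"
        unfolding path_algebra_mult using closed[OF that] by (intro sum.cong) auto
      then show ?thesis by simp
    qed
    moreover have "f \<otimes>\<^bsub>?A\<^esub> x \<in> carrier ?A"
      using f x by (simp add: vanishing_ideal_def)
    ultimately show ?thesis
      using f by (simp add: vanishing_ideal_def sum_distrib_right[symmetric])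
  qed
  show ?thesis
  proof (rule idealI[OF A.ring_axioms])
    show "subgroup ?J (add_monoid ?A)"
    proof (rule A.add.subgroupI)
      show "?J \<subseteq> carrier ?A" by (auto simp: vanishing_ideal_def)
      have "\<zero>\<^bsub>?A\<^esub> \<in> ?J" using A.zero_closed by (simp add: vanishing_ideal_def zero)
      then show "?J \<noteq> {}" by blast
      fix f assume f: "f \<in> ?J"
      have "\<ominus>\<^bsub>?A\<^esub> \<one>\<^bsub>?A\<^esub> \<otimes>\<^bsub>?A\<^esub> f \<in> ?J" by (intro left f) simp
      then show "\<ominus>\<^bsub>?A\<^esub> f \<in> ?J" using f A.l_minus[of "\<one>\<^bsub>?A\<^esub>" f] by (simp add: vanishing_ideal_def)
    next
      fix f g assume "f \<in> ?J" "g \<in> ?J"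
      then have "f \<oplus>\<^bsub>?A\<^esub> g \<in> carrier ?A" by (simp add: vanishing_ideal_def)
      with \<open>f \<in> ?J\<close> \<open>g \<in> ?J\<close> show "f \<oplus>\<^bsub>?A\<^esub> g \<in> ?J"
        by (simp add: vanishing_ideal_def add sum.distrib)
    qed
  qed (use left right in auto)
qed


section \<open>Half-edges and relations of a Brauer graph\<close>

definition opposite :: "'e half_edge \<Rightarrow> 'e half_edge" where
  "opposite h = (fst h, \<not> snd h)"

lemma fst_opposite [simp]: "fst (opposite h) = fst h"
  and opposite_neq [simp]: "opposite h \<noteq> h" "h \<noteq> opposite h"
  by (auto simp: opposite_def prod_eq_iff)

lemma fst_eq_iff_opposite: "fst h = fst h' \<longleftrightarrow> h' = h \<or> h' = opposite h"
  by (auto simp: opposite_def prod_eq_iff)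

locale brauer =
  fixes \<G> :: "('v,'e) brauer_graph"
  assumes brauer: "is_brauer_graph \<G>"
begin

abbreviation Q :: "('e, 'e half_edge) pre_digraph" where
  "Q \<equiv> brauer_quiver \<G>"

text \<open>A half-edge determines its vertex, so the successor functions of all non-truncated
  vertices combine into one map on the arrows.\<close>

definition next_at :: "'e half_edge \<Rightarrow> 'e half_edge" where
  "next_at h = succ_at \<G> (end_of \<G> h) h"

sublocale Q: fin_digraph Q
  by (rule fin_digraph_brauer_quiver[OF brauer])

sublocale U: fin_digraph "underlying \<G>"
  using brauer by (simp add: is_brauer_graph_def)

lemma end_of_in_verts: "fst h \<in> arcs (underlying \<G>) \<Longrightarrow> end_of \<G> h \<in> verts (underlying \<G>)"
  by (simp add: end_of_def)

lemma arcs_Q_iff: "h \<in> arcs Q \<longleftrightarrow> fst h \<in> arcs (underlying \<G>) \<and> end_of \<G> h \<in> nontruncated_verts \<G>"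
  by (auto simp: brauer_quiver_def half_edges_at_def)

lemma half_edges_at_iff:
  "v \<in> nontruncated_verts \<G> \<Longrightarrow> h \<in> half_edges_at \<G> v \<longleftrightarrow> h \<in> arcs Q \<and> end_of \<G> h = v"
  by (auto simp: arcs_Q_iff half_edges_at_def)

lemma tail_Q [simp]: "tail Q = fst"
  by (simp add: brauer_quiver_def)

lemma head_Q [simp]: "head Q h = fst (next_at h)"
  by (simp add: brauer_quiver_def next_at_def)

lemma finite_half_edges_at: "finite (half_edges_at \<G> v)"
  by (rule finite_subset[of _ "arcs (underlying \<G>) \<times> UNIV"]) (auto simp: half_edges_at_def)

lemma cyclic_on_next_at:
  assumes "v \<in> nontruncated_verts \<G>"
  shows "cyclic_on next_at (half_edges_at \<G> v)"
proof -
  have "cyclic_on (succ_at \<G> v) (half_edges_at \<G> v)"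
    using brauer assms by (simp add: is_brauer_graph_def)
  moreover have "next_at h = succ_at \<G> v h" if "h \<in> half_edges_at \<G> v" for h
    using that by (simp add: next_at_def half_edges_at_def)
  ultimately show ?thesis using cyclic_cong by blast
qed

lemma next_at_half_edges_at:
  "v \<in> nontruncated_verts \<G> \<Longrightarrow> h \<in> half_edges_at \<G> v \<Longrightarrow> next_at h \<in> half_edges_at \<G> v"
  using cyclic_on_inI[OF cyclic_on_next_at] .

lemma in_half_edges_at_end_of:
  assumes "h \<in> arcs Q"
  shows "end_of \<G> h \<in> nontruncated_verts \<G>" "h \<in> half_edges_at \<G> (end_of \<G> h)"
  using assms by (auto simp: arcs_Q_iff half_edges_at_def)

lemma next_at_arcs:
  assumes "h \<in> arcs Q"
  shows "next_at h \<in> arcs Q" "end_of \<G> (next_at h) = end_of \<G> h"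
  using next_at_half_edges_at[OF in_half_edges_at_end_of[OF assms]] in_half_edges_at_end_of[OF assms]
  by (simp_all add: half_edges_at_iff)

lemma funpow_next_at_arcs:
  assumes "h \<in> arcs Q"
  shows "(next_at ^^ k) h \<in> arcs Q" "end_of \<G> ((next_at ^^ k) h) = end_of \<G> h"
  using assms by (induction k) (auto simp: next_at_arcs)

text \<open>\<open>next_at\<close> preserves the vertex of an arrow, so two equal successors belong
  to one cyclic order, where the successor map is injective.\<close>

lemma inj_on_next_at: "inj_on next_at (arcs Q)"
proof (rule inj_onI)
  fix x y assume x: "x \<in> arcs Q" and y: "y \<in> arcs Q" and eq: "next_at x = next_at y"
  then have "end_of \<G> x = end_of \<G> y" by (metis next_at_arcs(2))
  then have "x \<in> half_edges_at \<G> (end_of \<G> x)" "y \<in> half_edges_at \<G> (end_of \<G> x)"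
    using x y in_half_edges_at_end_of(2) by fastforce+
  then show "x = y"
    using cyclic_on_inj_on[OF cyclic_on_next_at[OF in_half_edges_at_end_of(1)[OF x]] finite_half_edges_at] eq
    by (auto dest: inj_onD)
qed

lemma funpow_next_at_eqD:
  assumes "x \<in> arcs Q" "y \<in> arcs Q" "(next_at ^^ k) x = (next_at ^^ k) y"
  shows "x = y"
  using assms(3)
proof (induction k)
  case (Suc k)
  then show ?case
    using inj_onD[OF inj_on_next_at] funpow_next_at_arcs(1) assms(1,2) by auto
qed simp

lemma funpow_next_at_val:
  assumes "h \<in> arcs Q"
  shows "(next_at ^^ val \<G> (end_of \<G> h)) h = h"
  unfolding val_def
  by (rule cyclic_on_funpow_card[OF cyclic_on_next_at]) (use in_half_edges_at_end_of[OF assms] in auto)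

section \<open>Special cycles and their powers\<close>

lemma special_cycle_eq_iterates:
  assumes "v \<in> nontruncated_verts \<G>" "h \<in> half_edges_at \<G> v"
  shows "special_cycle \<G> v h = iterates next_at h (val \<G> v)"
proof -
  have h: "h \<in> arcs Q" "end_of \<G> h = v" using assms by (simp_all add: half_edges_at_iff)
  have "(succ_at \<G> v ^^ k) h = (next_at ^^ k) h" for k
  proof (induction k)
    case (Suc k)
    then show ?case using funpow_next_at_arcs(2)[OF h(1), of k] h(2) by (simp add: next_at_def[of "(next_at ^^ k) h"])
  qed simp
  then show ?thesis by (simp add: special_cycle_def iterates_def)
qed

text \<open>The power of \<open>A\<^bsub>v,h\<^esub>\<close> with exponent \<open>m(v)\<close> occurring in relations (I) and (II).\<close>

definition full_turn :: "'e half_edge \<Rightarrow> 'e half_edge list" where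
  "full_turn h = iterates next_at h (multiplicity \<G> (end_of \<G> h) * val \<G> (end_of \<G> h))"

lemma path_power_special_cycle:
  assumes "v \<in> nontruncated_verts \<G>" "h \<in> half_edges_at \<G> v"
  shows "path_power (special_cycle \<G> v h) (multiplicity \<G> v) = full_turn h"
proof -
  have h: "h \<in> arcs Q" "end_of \<G> h = v" using assms by (simp_all add: half_edges_at_iff)
  have "path_power (iterates next_at h (val \<G> v)) n = iterates next_at h (n * val \<G> v)" for n
  proof (induction n)
    case 0
    then show ?case by (simp add: path_power_def iterates_def)
  next
    case (Suc n)
    then show ?case
      using funpow_next_at_val[OF h(1)] by (simp add: path_power_def iterates_add h(2))
  qed
  then show ?thesis by (simp add: special_cycle_eq_iterates[OF assms] full_turn_def h(2))
qed

lemma multiplicity_pos: "v \<in> nontruncated_verts \<G> \<Longrightarrow> 0 < multiplicity \<G> v"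
  using brauer by (simp add: is_brauer_graph_def nontruncated_verts_def)

lemma val_pos: "h \<in> half_edges_at \<G> v \<Longrightarrow> 0 < val \<G> v"
  using finite_half_edges_at[of v] by (auto simp: val_def card_gt_0_iff)

text \<open>Non-truncation says that the product of valency and multiplicity is not 1. The bound
  makes room for an arrow and its successor inside the full turn.\<close>

lemma length_full_turn:
  assumes "h \<in> arcs Q"
  shows "2 \<le> length (full_turn h)"
proof -
  let ?v = "end_of \<G> h"
  have "0 < val \<G> ?v * multiplicity \<G> ?v"
    using val_pos[OF in_half_edges_at_end_of(2)] multiplicity_pos[OF in_half_edges_at_end_of(1)] assms
    by simp
  moreover have "val \<G> ?v * multiplicity \<G> ?v \<noteq> 1"
    using in_half_edges_at_end_of(1)[OF assms] by (simp add: nontruncated_verts_def truncated_def)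
  ultimately show ?thesis unfolding full_turn_def length_iterates by (simp only: mult.commute)
qed

lemma hd_full_turn:
  assumes "h \<in> arcs Q"
  shows "hd (full_turn h) = h"
  using length_full_turn[OF assms] unfolding full_turn_def length_iterates by (intro hd_iterates) linarith

lemma set_full_turn:
  assumes "h \<in> arcs Q" "x \<in> set (full_turn h)"
  shows "x \<in> arcs Q" "end_of \<G> x = end_of \<G> h"
  using assms funpow_next_at_arcs[OF assms(1)] by (auto simp: full_turn_def set_iterates)

lemma successively_full_turn: "successively (\<lambda>x y. y = next_at x) (full_turn h)"
  unfolding full_turn_def by (rule successively_iterates)

text \<open>Containment puts \<open>h\<close> at the vertex of \<open>x\<close>, where all full
  turns have the same length; so the two lists coincide, and so do their heads.\<close>

lemma sublist_full_turn:
  assumes "x \<in> arcs Q" "h \<in> arcs Q" "sublist (full_turn h) (full_turn x)"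
  shows "h = x"
proof -
  have "h \<in> set (full_turn h)"
    using length_full_turn[OF assms(2)] hd_full_turn[OF assms(2)] hd_in_set[of "full_turn h"] by fastforce
  then have "h \<in> set (full_turn x)" using set_mono_sublist[OF assms(3)] by blast
  then have "end_of \<G> h = end_of \<G> x" by (rule set_full_turn(2)[OF assms(1)])
  then have "length (full_turn h) = length (full_turn x)" by (simp add: full_turn_def)
  with assms(3) have "full_turn h = full_turn x" by (auto simp: sublist_def)
  then show ?thesis using hd_full_turn assms by metis
qed

lemma awalk_full_turn:
  assumes "h \<in> arcs Q"
  shows "Q.awalk (fst h) (full_turn h) (fst h)"
proof -
  let ?v = "end_of \<G> h"
  note v = in_half_edges_at_end_of[OF assms]
  have "Q.awalk (fst h) (path_power (special_cycle \<G> ?v h) n) (fst h)" for n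
  proof (induction n)
    case 0
    have "fst h \<in> verts Q" using Q.tail_in_verts[OF assms] by simp
    then show ?case by (simp add: path_power_def Q.awalk_Nil_iff)
  next
    case (Suc n)
    then show ?case using special_cycle_awalk[OF brauer v] by (auto simp: path_power_def)
  qed
  then show ?thesis using path_power_special_cycle[OF v] by metis
qed

lemma next_at_val_1:
  assumes "h \<in> arcs Q" "val \<G> (end_of \<G> h) = 1"
  shows "next_at h = h"
  using funpow_next_at_val[OF assms(1)] assms(2) by simp

section \<open>Products of two arrows and the ideal\<close>

lemma sublist_special_cycle:
  assumes "a \<in> arcs Q" "1 < val \<G> (end_of \<G> a)"
  shows "sublist [a, next_at a] (special_cycle \<G> (end_of \<G> a) a)"
proof -
  have "special_cycle \<G> (end_of \<G> a) a = iterates next_at a (2 + (val \<G> (end_of \<G> a) - 2))"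
    using assms(2) by (simp add: special_cycle_eq_iterates[OF in_half_edges_at_end_of[OF assms(1)]] del: One_nat_def add_2_eq_Suc)
  also have "\<dots> = [a, next_at a] @ iterates next_at ((next_at ^^ 2) a) (val \<G> (end_of \<G> a) - 2)"
    unfolding iterates_add by (simp add: iterates_def numeral_2_eq_2)
  finally show ?thesis by (metis sublist_append_rightI)
qed

text \<open>The vanishing ideal for the full turns based at the edge of \<open>a\<close> contains
  all relations, hence \<open>brauer_ideal\<close>, but not this product.\<close>

lemma path_elem_notin_brauer_ideal:
  assumes a: "a \<in> arcs Q"
  shows "(path_elem Q [a, next_at a] :: 'e \<times> 'e half_edge list \<Rightarrow> 'k::field) \<notin> brauer_ideal \<G>"
proof -
  let ?A = "path_algebra Q :: ('e \<times> 'e half_edge list \<Rightarrow> 'k) ring"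
  let ?R = "relations_I \<G> \<union> relations_II \<G> \<union> relations_III \<G> :: ('e \<times> 'e half_edge list \<Rightarrow> 'k) set"
  interpret A: ring ?A by (rule ring_path_algebra) (auto intro: Q.wf_digraph)
  \<comment> \<open>\<open>X\<close> consists of \<open>a\<close> and, if it is an arrow, the other
    half of the same edge; \<open>C\<close> holds the full turns that relations (I) compare at this
    edge.\<close>
  define X where "X = {h \<in> arcs Q. fst h = fst a}"
  define C where "C = full_turn ` X"
  define J where "J = (vanishing_ideal Q (fst a) C :: ('e \<times> 'e half_edge list \<Rightarrow> 'k) set)"
  have R_carrier: "?R \<subseteq> carrier ?A" by (rule relations_carrier[OF brauer])
  have finC: "finite C" by (simp add: C_def X_def)
  have "ideal J ?A"
    unfolding J_def
    by (rule ideal_vanishing_ideal[OF Q.fin_digraph]) (auto simp: C_def X_def dest: awalk_full_turn)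
  have sum_full_turn: "(\<Sum>p\<in>C. path_elem Q (full_turn h) (fst a, p)) = (of_bool (fst h = fst a) :: 'k)"
    if h: "h \<in> arcs Q" for h
  proof -
    have "full_turn h \<in> C" if "fst h = fst a" using h that by (auto simp: C_def X_def)
    moreover have "(\<Sum>p\<in>C. path_elem Q (full_turn h) (fst a, p) :: 'k) =
        (\<Sum>p\<in>C. if full_turn h = p then of_bool (fst h = fst a) else 0)"
      by (rule sum.cong) (auto simp: path_elem_def hd_full_turn[OF h])
    ultimately show ?thesis using finC by (cases "fst h = fst a") simp_all
  qed
  \<comment> \<open>A path that is no subpath of a full turn vanishes wherever \<open>J\<close>
    imposes a condition; this covers relations (II) and (III).\<close>
  have J_path: "path_elem Q w \<in> J"
    if "path_elem Q w \<in> carrier ?A" and not_sub: "\<And>x. x \<in> arcs Q \<Longrightarrow> \<not> sublist w (full_turn x)" for w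
  proof -
    have "path_elem Q w (u, q) = (0::'k)" if "p \<in> C" "sublist q p" for p q u
      using that not_sub by (auto simp: C_def X_def path_elem_def)
    then show ?thesis using that(1) by (auto simp: J_def vanishing_ideal_def intro!: sum.neutral)
  qed
  have "relations_I \<G> \<subseteq> J"
  proof
    fix r :: "'e \<times> 'e half_edge list \<Rightarrow> 'k" assume r: "r \<in> relations_I \<G>"
    then have carrier: "r \<in> carrier ?A" using R_carrier by blast
    from r obtain h h' where h: "h \<in> arcs Q" "h' \<in> arcs Q" "fst h = fst h'"
      and r: "r = (\<lambda>p. path_elem Q (full_turn h) p - path_elem Q (full_turn h') p)"
      unfolding relations_I_def
      by (auto simp: path_power_special_cycle half_edges_at_iff)
    \<comment> \<open>A full turn is never a proper subpath of another one. In the sum over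
      \<open>C\<close> the two terms cancel because \<open>h\<close> and \<open>h'\<close> belong to
      the same edge.\<close>
    have "r (u, q) = 0" if p: "p \<in> C" "sublist q p" "q \<noteq> p" for p q u
    proof -
      obtain x where "x \<in> arcs Q" "p = full_turn x" using p(1) unfolding C_def X_def by blast
      then have "q \<noteq> full_turn h" "q \<noteq> full_turn h'"
        using p(2,3) sublist_full_turn h(1,2) by blast+
      then show ?thesis by (simp add: r path_elem_def)
    qed
    moreover have "(\<Sum>p\<in>C. r (fst a, p)) = 0"
      by (simp add: r sum_subtractf sum_full_turn h)
    ultimately show "r \<in> J" using carrier by (simp add: J_def vanishing_ideal_def)
  qed
  moreover have "relations_II \<G> \<subseteq> J"
  proof
    fix r :: "'e \<times> 'e half_edge list \<Rightarrow> 'k" assume r: "r \<in> relations_II \<G>"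
    then have carrier: "r \<in> carrier ?A" using R_carrier by blast
    from r obtain v h where v: "v \<in> nontruncated_verts \<G>" "h \<in> half_edges_at \<G> v"
      and r: "r = path_elem Q
        (path_power (special_cycle \<G> v h) (multiplicity \<G> v) @ [hd (special_cycle \<G> v h)])"
      unfolding relations_II_def by blast
    define c where "c = hd (special_cycle \<G> v h)"
    have h: "h \<in> arcs Q" and r: "r = path_elem Q (full_turn h @ [c])"
      using v by (simp_all add: r c_def path_power_special_cycle half_edges_at_iff)
    \<comment> \<open>Only \<open>x = h\<close> is possible, and then the list is one arrow too
      long.\<close>
    have "\<not> sublist (full_turn h @ [c]) (full_turn x)" if x: "x \<in> arcs Q" for x
    proof
      assume sub: "sublist (full_turn h @ [c]) (full_turn x)"
      then have "h = x"
        using sublist_full_turn[OF x h] by (metis sublist_append_rightI sublist_order.order.trans)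
      with sublist_length_le[OF sub] show False by simp
    qed
    then show "r \<in> J" using J_path carrier by (simp add: r)
  qed
  moreover have "relations_III \<G> \<subseteq> J"
  proof
    fix r :: "'e \<times> 'e half_edge list \<Rightarrow> 'k" assume r: "r \<in> relations_III \<G>"
    then have carrier: "r \<in> carrier ?A" using R_carrier by blast
    from r obtain x y where xy: "x \<in> arcs Q"
        "\<not> (\<exists>v \<in> nontruncated_verts \<G>. \<exists>h \<in> half_edges_at \<G> v. sublist [x, y] (special_cycle \<G> v h))"
        "\<not> (x = y \<and> (\<exists>v \<in> nontruncated_verts \<G>. x \<in> half_edges_at \<G> v \<and> val \<G> v = 1))"
      and r: "r = path_elem Q [x, y]"
      unfolding relations_III_def by blast
    \<comment> \<open>At valency 1 the successor of \<open>x\<close> is \<open>x\<close>, the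
      exceptional case of (III); at larger valency \<open>x\<close> and its successor are
      consecutive in a special cycle.\<close>
    have "y \<noteq> next_at x"
    proof (cases "val \<G> (end_of \<G> x) = 1")
      case True
      then show ?thesis using xy(1,3) next_at_val_1 in_half_edges_at_end_of by metis
    next
      case False
      with val_pos[OF in_half_edges_at_end_of(2)[OF xy(1)]] have "1 < val \<G> (end_of \<G> x)" by simp
      then show ?thesis
        using xy(1,2) sublist_special_cycle in_half_edges_at_end_of by metis
    qed
    then have "\<not> sublist [x, y] (full_turn z)" for z
      using successively_sublist[OF successively_full_turn, of "[x, y]" z] by auto
    then show "r \<in> J" using J_path carrier by (simp add: r)
  qed
  ultimately have "?R \<subseteq> J" by blast
  then have "brauer_ideal \<G> \<subseteq> J"
    unfolding brauer_ideal_def by (rule A.genideal_minimal[OF \<open>ideal J ?A\<close>])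
  \<comment> \<open>If the full turn of \<open>a\<close> has just these two arrows, the sum over
    \<open>C\<close> is 1 instead of 0. Otherwise the product is a proper subpath of it, where
    elements of \<open>J\<close> vanish.\<close>
  moreover have "(path_elem Q [a, next_at a] :: 'e \<times> 'e half_edge list \<Rightarrow> 'k) \<notin> J"
  proof (cases "[a, next_at a] = full_turn a")
    case True
    then show ?thesis using sum_full_turn[OF a] by (auto simp: J_def vanishing_ideal_def)
  next
    case False
    let ?n = "multiplicity \<G> (end_of \<G> a) * val \<G> (end_of \<G> a)"
    have "full_turn a = iterates next_at a (2 + (?n - 2))"
      using length_full_turn[OF a] by (simp only: full_turn_def length_iterates le_add_diff_inverse)
    also have "\<dots> = [a, next_at a] @ iterates next_at ((next_at ^^ 2) a) (?n - 2)"
      unfolding iterates_add by (simp add: iterates_def numeral_2_eq_2)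
    finally have "sublist [a, next_at a] (full_turn a)" by (metis sublist_append_rightI)
    moreover have "full_turn a \<in> C" using a by (simp add: C_def X_def)
    ultimately have "f (fst a, [a, next_at a]) = 0" if "f \<in> J" for f
      using False that by (auto simp: J_def vanishing_ideal_def)
    from this[of "path_elem Q [a, next_at a]"] show ?thesis by (auto simp: path_elem_def)
  qed
  ultimately show ?thesis by blast
qed

text \<open>Consecutive arrows of a special cycle are successors, and at valency 1 a half-edge is
  its own successor. So if \<open>b\<close> is not the successor of \<open>a\<close>, the product is
  itself a relation (III).\<close>

lemma path_elem_in_brauer_ideal_iff:
  assumes "a \<in> arcs Q" "b \<in> arcs Q" "fst (next_at a) = fst b"
  shows "(path_elem Q [a, b] :: 'e \<times> 'e half_edge list \<Rightarrow> 'k::field) \<in> brauer_ideal \<G> \<longleftrightarrow> b \<noteq> next_at a"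
proof
  assume "path_elem Q [a, b] \<in> (brauer_ideal \<G> :: ('e \<times> 'e half_edge list \<Rightarrow> 'k) set)"
  then show "b \<noteq> next_at a" using path_elem_notin_brauer_ideal[OF assms(1), where 'k = 'k] by blast
next
  assume neq: "b \<noteq> next_at a"
  interpret A: ring "path_algebra Q :: ('e \<times> 'e half_edge list \<Rightarrow> 'k) ring"
    by (rule ring_path_algebra) (auto intro: Q.wf_digraph)
  have "\<not> sublist [a, b] (special_cycle \<G> v h)" if "v \<in> nontruncated_verts \<G>" "h \<in> half_edges_at \<G> v" for v h
    using successively_sublist[OF successively_iterates, of "[a, b]" next_at h "val \<G> v"] neq
    by (auto simp: special_cycle_eq_iterates[OF that])
  moreover have "\<not> (a = b \<and> (\<exists>v \<in> nontruncated_verts \<G>. a \<in> half_edges_at \<G> v \<and> val \<G> v = 1))"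
    using neq next_at_val_1[OF assms(1)] by (auto simp: half_edges_at_iff)
  ultimately have "path_elem Q [a, b] \<in> (relations_III \<G> :: ('e \<times> 'e half_edge list \<Rightarrow> 'k) set)"
    unfolding relations_III_def using assms
    by (intro CollectI exI[of _ a] exI[of _ b]) (simp; blast)
  then show "path_elem Q [a, b] \<in> (brauer_ideal \<G> :: ('e \<times> 'e half_edge list \<Rightarrow> 'k) set)"
    using A.genideal_self[OF relations_carrier[OF brauer]] unfolding brauer_ideal_def by blast
qed

end

section \<open>Maximal unramified paths\<close>

context brauer
begin

lemma next_at_image: "next_at ` arcs Q = arcs Q"
  by (rule endo_inj_surj) (auto simp: inj_on_next_at next_at_arcs)

text \<open>The head of an arrow is the tail of its successor, so \<open>next_at\<close> maps the
  arrows into \<open>e\<close> bijectively onto those out of \<open>e\<close>. The two degree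
  conditions of \<open>unramified_path\<close> thus become one.\<close>

lemma in_degree_eq_out_degree: "in_degree Q e = out_degree Q e"
proof -
  have "out_arcs Q e = next_at ` in_arcs Q e"
    using next_at_image by (force simp: out_arcs_def in_arcs_def)
  moreover have "inj_on next_at (in_arcs Q e)"
    by (rule inj_on_subset[OF inj_on_next_at]) auto
  ultimately show ?thesis by (simp add: in_degree_def out_degree_def card_image)
qed

definition ramified :: "'e half_edge \<Rightarrow> bool" where
  "ramified h \<longleftrightarrow> opposite h \<in> arcs Q"

lemma out_degree_eq_1_iff:
  assumes "h \<in> arcs Q"
  shows "out_degree Q (fst h) = 1 \<longleftrightarrow> \<not> ramified h"
proof -
  have "out_arcs Q (fst h) = (if ramified h then {h, opposite h} else {h})"
  proof -
    have "x \<in> out_arcs Q (fst h) \<longleftrightarrow> x \<in> arcs Q \<and> (x = h \<or> x = opposite h)" for x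
      unfolding in_out_arcs_conv tail_Q using fst_eq_iff_opposite[of h x] by metis
    then show ?thesis using assms unfolding ramified_def set_eq_iff by simp metis
  qed
  then show ?thesis by (simp add: out_degree_def)
qed

text \<open>If only one arrow starts at the head of \<open>x\<close>, it is the successor of
  \<open>x\<close>, and composability leaves no other choice for \<open>y\<close>.\<close>

lemma unramified_path_iff:
  "unramified_path Q w \<longleftrightarrow>
    w \<noteq> [] \<and> set w \<subseteq> arcs Q \<and> successively (\<lambda>x y. y = next_at x \<and> \<not> ramified y) w"
proof (cases "w = [] \<or> \<not> set w \<subseteq> arcs Q")
  case True
  then show ?thesis using Q.ex_awalk_iff[of w] by (auto simp: unramified_path_def)
next
  case False
  have "(fst (next_at x) = fst y \<and> out_degree Q (fst (next_at x)) = 1) \<longleftrightarrow> (y = next_at x \<and> \<not> ramified y)"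
    if "x \<in> arcs Q" "y \<in> arcs Q" for x y
    using that out_degree_eq_1_iff[OF next_at_arcs(1)[OF that(1)]] fst_eq_iff_opposite[of "next_at x" y]
    unfolding ramified_def by metis
  then have step: "(fst (next_at (w ! i)) = fst (w ! Suc i) \<and> out_degree Q (fst (next_at (w ! i))) = 1) \<longleftrightarrow>
      (w ! Suc i = next_at (w ! i) \<and> \<not> ramified (w ! Suc i))" if "Suc i < length w" for i
    using False that by (meson Suc_lessD nth_mem subsetD)
  have "unramified_path Q w \<longleftrightarrow> (\<forall>i. Suc i < length w \<longrightarrow>
      fst (next_at (w ! i)) = fst (w ! Suc i) \<and> out_degree Q (fst (next_at (w ! i))) = 1)"
    using False Q.ex_awalk_iff[of w]
    by (auto simp: unramified_path_def successively_conv_nth in_degree_eq_out_degree)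
  also have "\<dots> \<longleftrightarrow> successively (\<lambda>x y. y = next_at x \<and> \<not> ramified y) w"
    using step by (auto simp: successively_conv_nth)
  finally show ?thesis using False by simp
qed

section \<open>Segments between consecutive ramified half-edges\<close>

definition segment_length :: "'e half_edge \<Rightarrow> nat" where
  "segment_length r = (LEAST n. 0 < n \<and> ramified ((next_at ^^ n) r))"

definition segment :: "'e half_edge \<Rightarrow> 'e half_edge list" where
  "segment r = iterates next_at r (segment_length r)"

text \<open>A full round leads from \<open>r\<close> back to \<open>r\<close>, which is ramified, so
  the least number in \<open>segment_length\<close> exists.\<close>

lemma segment_length:
  assumes "r \<in> arcs Q" "ramified r"
  shows "0 < segment_length r" "ramified ((next_at ^^ segment_length r) r)"
proof -
  have "0 < val \<G> (end_of \<G> r)" using val_pos[OF in_half_edges_at_end_of(2)[OF assms(1)]] .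
  moreover have "ramified ((next_at ^^ val \<G> (end_of \<G> r)) r)"
    using funpow_next_at_val[OF assms(1)] assms(2) by simp
  ultimately have "0 < segment_length r \<and> ramified ((next_at ^^ segment_length r) r)"
    unfolding segment_length_def by (intro LeastI[where P = "\<lambda>n. 0 < n \<and> ramified ((next_at ^^ n) r)"]) simp
  then show "0 < segment_length r" "ramified ((next_at ^^ segment_length r) r)" by auto
qed

lemma not_ramified_segment:
  "0 < j \<Longrightarrow> j < segment_length r \<Longrightarrow> \<not> ramified ((next_at ^^ j) r)"
  unfolding segment_length_def using not_less_Least by blast

lemma unramified_path_segment:
  assumes "r \<in> arcs Q" "ramified r"
  shows "unramified_path Q (segment r)"
  using segment_length(1)[OF assms] funpow_next_at_arcs(1)[OF assms(1)] not_ramified_segment[of _ r]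
  by (auto simp: unramified_path_iff segment_def set_iterates successively_conv_nth simp del: funpow.simps)
    auto

text \<open>
  An unramified path cannot be extended to the left beyond \<open>r\<close> nor to the right beyond the next
  ramified half-edge, since only its first arrow may be ramified.
\<close>

lemma unramified_path_le_segment:
  assumes r: "r \<in> arcs Q" "ramified r" and k: "k < segment_length r"
    and w: "unramified_path Q w" "(next_at ^^ k) r \<in> set w"
  shows "length w \<le> segment_length r" "length w = segment_length r \<Longrightarrow> w = segment r"
proof -
  obtain i where i: "i < length w" "w ! i = (next_at ^^ k) r" using w(2) by (auto simp: in_set_conv_nth)
  have arcs: "w ! j \<in> arcs Q" if "j < length w" for j using w(1) that by (auto simp: unramified_path_iff)
  have succ: "successively (\<lambda>x y. y = next_at x) w"
    using w(1) by (auto simp: unramified_path_iff elim: successively_mono)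
  have unram: "\<not> ramified (w ! j)" if "0 < j" "j < length w" for j
    using w(1) that successively_nth[of _ w "j - 1"] by (auto simp: unramified_path_iff)
  \<comment> \<open>Otherwise \<open>r\<close> would stand at the positive position
    \<open>i - k\<close> of \<open>w\<close>, but only the first entry of \<open>w\<close> may be
    ramified.\<close>
  have "i \<le> k"
  proof (rule ccontr)
    assume "\<not> i \<le> k"
    then have "(next_at ^^ k) (w ! (i - k)) = (next_at ^^ k) r"
      using successively_nth_funpow[OF succ, of "i - k" k] i by simp
    then have "w ! (i - k) = r"
      using funpow_next_at_eqD arcs[of "i - k"] r(1) i(1) by auto
    then show False using unram[of "i - k"] r(2) \<open>\<not> i \<le> k\<close> i(1) by (simp add: less_imp_diff_less)
  qed
  have "(next_at ^^ i) (w ! 0) = (next_at ^^ i) ((next_at ^^ (k - i)) r)"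
    using successively_nth_funpow[OF succ, of 0 i] i \<open>i \<le> k\<close>
    by (simp add: funpow_funpow)
  then have w0: "w ! 0 = (next_at ^^ (k - i)) r"
    using funpow_next_at_eqD[of "w ! 0"] arcs[of 0] funpow_next_at_arcs(1)[OF r(1)] i(1)
    by (metis less_nat_zero_code neq0_conv)
  have len: "length w + (k - i) \<le> segment_length r"
  proof (rule ccontr)
    \<comment> \<open>The position in \<open>w\<close> at which the ramified half-edge following the
      segment would appear.\<close>
    let ?j = "segment_length r - (k - i)"
    assume "\<not> ?thesis"
    then have j: "0 < ?j" "?j < length w" "k - i + ?j = segment_length r" using k by auto
    then have "w ! ?j = (next_at ^^ segment_length r) r"
      using successively_nth_funpow[OF succ, of 0 ?j] w0 by (simp add: funpow_funpow add.commute)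
    then show False using unram[OF j(1,2)] segment_length(2)[OF r] by simp
  qed
  then show "length w \<le> segment_length r" by simp
  show "w = segment r" if "length w = segment_length r"
  proof -
    have "w ! 0 = r" using len that w0 by simp
    moreover have "w \<noteq> []" using i by auto
    ultimately show ?thesis
      using successively_eq_iterates[OF succ] that by (simp add: segment_def hd_conv_nth)
  qed
qed

text \<open>Segments are unramified, and \<open>unramified_path_le_segment\<close> makes this one
  the only unramified path through \<open>a\<close> of maximal length.\<close>

lemma omega_segment:
  assumes "\<not> cyclic_quiver Q" "r \<in> arcs Q" "ramified r" "a \<in> set (segment r)"
  shows "omega Q a = segment r"
proof -
  obtain k where k: "k < segment_length r" "a = (next_at ^^ k) r"
    using assms(4) by (auto simp: segment_def set_iterates)
  note le = unramified_path_le_segment[OF assms(2,3) k(1), folded k(2)]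
  have "(THE w. unramified_path Q w \<and> a \<in> set w \<and>
      (\<forall>w'. unramified_path Q w' \<and> a \<in> set w' \<longrightarrow> length w' \<le> length w)) = segment r"
  proof (rule the_equality)
    show "unramified_path Q (segment r) \<and> a \<in> set (segment r) \<and>
        (\<forall>w'. unramified_path Q w' \<and> a \<in> set w' \<longrightarrow> length w' \<le> length (segment r))"
      using unramified_path_segment[OF assms(2,3)] assms(4) le(1) by (auto simp: segment_def)
    fix w assume w: "unramified_path Q w \<and> a \<in> set w \<and>
        (\<forall>w'. unramified_path Q w' \<and> a \<in> set w' \<longrightarrow> length w' \<le> length w)"
    then have "segment_length r \<le> length w"
      using unramified_path_segment[OF assms(2,3)] assms(4) by (auto simp: segment_def)
    then show "w = segment r" using le w by (meson le_antisym)
  qed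
  then show ?thesis using assms(1) by (simp add: omega_def)
qed

text \<open>
  Without a ramified half-edge at \<open>v\<close>, all neighbours of \<open>v\<close> are truncated leaves, so that the
  connected graph is a star with centre \<open>v\<close>.
\<close>

lemma star_of_no_ramified:
  assumes v: "v \<in> nontruncated_verts \<G>" and unram: "\<And>h. h \<in> half_edges_at \<G> v \<Longrightarrow> \<not> ramified h"
  shows "arcs Q = half_edges_at \<G> v" "fst ` half_edges_at \<G> v = verts Q"
proof -
  \<comment> \<open>\<open>P\<close> describes \<open>v\<close> and the other ends of its edges. It
    will turn out to be closed under passing along edges, hence true everywhere.\<close>
  define P where "P u \<longleftrightarrow> u = v \<or> (\<exists>h \<in> half_edges_at \<G> v. u = end_of \<G> (opposite h))" for u
  have trunc: "truncated \<G> (end_of \<G> (opposite h))" if "h \<in> half_edges_at \<G> v" for h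
    using unram[OF that] that end_of_in_verts[of "opposite h"]
    by (auto simp: ramified_def arcs_Q_iff nontruncated_verts_def half_edges_at_def)
  \<comment> \<open>A truncated vertex has valency 1, so \<open>opposite h\<close> is the only
    half-edge there.\<close>
  have leaf: "x = opposite h"
    if "h \<in> half_edges_at \<G> v" "fst x \<in> arcs (underlying \<G>)" "end_of \<G> x = end_of \<G> (opposite h)" for h x
  proof -
    have "card (half_edges_at \<G> (end_of \<G> (opposite h))) = 1"
      using trunc[OF that(1)] by (simp add: truncated_def val_def)
    moreover have "x \<in> half_edges_at \<G> (end_of \<G> (opposite h))"
        "opposite h \<in> half_edges_at \<G> (end_of \<G> (opposite h))"
      using that by (auto simp: half_edges_at_def)
    ultimately show ?thesis by (auto simp: card_1_singleton_iff)
  qed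
  have P_opposite: "P (end_of \<G> (opposite x))"
    if x: "fst x \<in> arcs (underlying \<G>)" and P: "P (end_of \<G> x)" for x
  proof (cases "end_of \<G> x = v")
    case True
    then have "x \<in> half_edges_at \<G> v" using x by (simp add: half_edges_at_def)
    then show ?thesis unfolding P_def by blast
  next
    case False
    then obtain h where h: "h \<in> half_edges_at \<G> v" "end_of \<G> x = end_of \<G> (opposite h)"
      using P by (auto simp: P_def)
    then have "opposite x = h" using leaf[OF h(1) x h(2)] by (simp add: opposite_def)
    then show ?thesis using h(1) by (simp add: P_def half_edges_at_def)
  qed
  have step: "P (tail (underlying \<G>) e) \<longleftrightarrow> P (head (underlying \<G>) e)" if "e \<in> arcs (underlying \<G>)" for e
    using P_opposite[of "(e, False)"] P_opposite[of "(e, True)"] that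
    by (auto simp: end_of_def opposite_def)
  have P: "P u" if "u \<in> verts (underlying \<G>)" for u
  proof (rule connected_invariant[of "underlying \<G>" P v])
    show "connected (underlying \<G>)" using brauer by (simp add: is_brauer_graph_def)
  qed (use step that v in \<open>auto simp: P_def nontruncated_verts_def\<close>)
  have "u = v" if "u \<in> nontruncated_verts \<G>" for u
    using P[of u] that trunc by (auto simp: P_def nontruncated_verts_def)
  then have "nontruncated_verts \<G> = {v}" using v by blast
  then show "arcs Q = half_edges_at \<G> v" by (simp add: brauer_quiver_def)
  have "e \<in> fst ` half_edges_at \<G> v" if e: "e \<in> arcs (underlying \<G>)" for e
  proof -
    have "P (end_of \<G> (e, False))" using e by (intro P end_of_in_verts) simp
    then consider "(e, False) \<in> half_edges_at \<G> v"
      | h where "h \<in> half_edges_at \<G> v" "(e, False) = opposite h"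
      using leaf[of _ "(e, False)"] e by (auto simp: P_def half_edges_at_def)
    then show ?thesis by cases (force, metis fst_conv fst_opposite image_eqI)
  qed
  then show "fst ` half_edges_at \<G> v = verts Q"
    by (auto simp: brauer_quiver_def half_edges_at_def)
qed

section \<open>Covering the arrows by segments or by a full cycle\<close>

lemma special_cycle_properties:
  assumes "v \<in> nontruncated_verts \<G>" "h \<in> half_edges_at \<G> v"
  shows "set (special_cycle \<G> v h) = half_edges_at \<G> v" "distinct (special_cycle \<G> v h)"
  using iterates_cyclic_on[OF cyclic_on_next_at[OF assms(1)] finite_half_edges_at assms(2)]
  by (simp_all add: special_cycle_eq_iterates[OF assms] val_def)

text \<open>Otherwise the graph is a star around \<open>v\<close>, and the special cycle at
  \<open>v\<close> runs exactly once through all arrows and vertices of the quiver.\<close>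

lemma ex_ramified:
  assumes "\<not> cyclic_quiver Q" and v: "v \<in> nontruncated_verts \<G>"
  obtains r where "r \<in> half_edges_at \<G> v" "ramified r"
proof -
  have False if unram: "\<And>r. r \<in> half_edges_at \<G> v \<Longrightarrow> \<not> ramified r"
  proof -
    have star: "arcs Q = half_edges_at \<G> v" "fst ` half_edges_at \<G> v = verts Q"
      by (rule star_of_no_ramified[OF v]; use unram in blast)+
    obtain h where h: "h \<in> half_edges_at \<G> v"
      using cyclic_on_next_at[OF v] by (auto simp: cyclic_on_def)
    let ?w = "special_cycle \<G> v h"
    note w = special_cycle_properties[OF v h]
    have walk: "Q.awalk (fst h) ?w (fst h)" by (rule special_cycle_awalk[OF brauer v h])
    have ne: "?w \<noteq> []" using w(1) h by auto
    \<comment> \<open>Two distinct arrows starting at the same edge would be its two halves, and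
      both would be ramified.\<close>
    have "inj_on fst (arcs Q)"
      using unram unfolding star(1) by (auto simp: inj_on_def ramified_def fst_eq_iff_opposite star(1) simp del: split_paired_All)
    then have inj: "inj_on (head Q) (arcs Q)"
      using comp_inj_on[OF inj_on_next_at, of fst] by (simp add: next_at_image comp_def inj_on_def)
    have "tl (Q.awalk_verts (fst h) ?w) = map (head Q) ?w"
      using Q.awalk_verts_conv'[of "fst h" ?w "fst h"] walk ne by (simp add: Q.awalk_def)
    then have "distinct (tl (Q.awalk_verts (fst h) ?w))"
      using inj w star(1) by (simp add: distinct_map)
    then have "Q.cycle ?w" using walk ne by (auto simp: Q.cycle_def)
    moreover have "head Q ` set ?w = verts Q"
    proof -
      have "head Q ` set ?w = fst ` (next_at ` arcs Q)"
        by (simp add: w(1) star(1) image_image)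
      also have "\<dots> = fst ` arcs Q" unfolding next_at_image ..
      finally show ?thesis unfolding star .
    qed
    ultimately have "full_cycle Q ?w" by (simp add: full_cycle_def w star(1))
    then show False using assms(1) by (auto simp: cyclic_quiver_def)
  qed
  then show ?thesis using that by blast
qed

text \<open>Among the ramified half-edges from which \<open>a\<close> is reached, \<open>r\<close>
  needs the fewest steps. If these were at least \<open>segment_length r\<close>, the ramified
  half-edge following the segment would need fewer.\<close>

lemma ex_segment:
  assumes "\<not> cyclic_quiver Q" and a: "a \<in> arcs Q"
  obtains r where "r \<in> arcs Q" "ramified r" "a \<in> set (segment r)"
proof -
  let ?v = "end_of \<G> a"
  let ?P = "\<lambda>k. \<exists>r. r \<in> arcs Q \<and> ramified r \<and> a = (next_at ^^ k) r"
  note v = in_half_edges_at_end_of[OF a]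
  obtain r where r: "r \<in> half_edges_at \<G> ?v" "ramified r"
    using ex_ramified[OF assms(1) v(1)] by blast
  have "a \<in> orbit next_at r"
    using orbit_cyclic_eq3[OF cyclic_on_next_at[OF v(1)] r(1)] v(2) by simp
  then obtain n where "a = (next_at ^^ n) r" by (auto simp: orbit_altdef)
  then have "?P n" using r half_edges_at_iff[OF v(1)] by blast
  then have "?P (LEAST k. ?P k)" by (rule LeastI)
  then obtain r where r: "r \<in> arcs Q" "ramified r" "a = (next_at ^^ (LEAST k. ?P k)) r" by blast
  let ?k = "LEAST k. ?P k" and ?n = "segment_length r"
  have "?k < ?n"
  proof (rule ccontr)
    assume "\<not> ?k < ?n"
    then have "a = (next_at ^^ (?k - ?n)) ((next_at ^^ ?n) r)"
      using r(3) unfolding funpow_funpow by simp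
    then have "?P (?k - ?n)"
      using segment_length(2)[OF r(1,2)] funpow_next_at_arcs(1)[OF r(1)] by blast
    then have "?k \<le> ?k - ?n" by (rule Least_le)
    then show False using \<open>\<not> ?k < ?n\<close> segment_length(1)[OF r(1,2)] by simp
  qed
  then have "a \<in> set (segment r)" using r(3) by (auto simp: segment_def set_iterates)
  then show ?thesis using that r by blast
qed

text \<open>Distinct vertices along the cycle make \<open>head Q\<close> injective on the arrows. An
  arrow starting where \<open>x\<close> ends is the successor of some arrow with the head of
  \<open>x\<close>, hence of \<open>x\<close>.\<close>

lemma full_cycle_successively:
  assumes "full_cycle Q w"
  shows "w \<noteq> []" "set w = arcs Q" "distinct w" "successively (\<lambda>x y. y = next_at x) w"
    "hd w = next_at (last w)"
proof -
  obtain u where walk: "Q.awalk u w u" and dist: "distinct (tl (Q.awalk_verts u w))" and ne: "w \<noteq> []"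
    and set: "set w = arcs Q"
    using assms by (auto simp: full_cycle_def Q.cycle_def)
  show "w \<noteq> []" "set w = arcs Q" by fact+
  have cas: "Q.cas u w u" using walk by (simp add: Q.awalk_def)
  have "distinct (map (head Q) w)"
    using dist Q.awalk_verts_conv'[OF cas] ne by simp
  then have inj: "inj_on (head Q) (arcs Q)" and "distinct w" by (simp_all add: distinct_map set)
  then show "distinct w" by simp
  have step: "y = next_at x" if xy: "x \<in> arcs Q" "y \<in> arcs Q" "head Q x = fst y" for x y
  proof -
    obtain z where z: "z \<in> arcs Q" "y = next_at z" using xy(2) next_at_image by (metis imageE)
    then have "x = z" using inj_onD[OF inj, of x z] xy by simp
    with z show ?thesis by simp
  qed
  have "successively (\<lambda>a b. head Q a = tail Q b) w" using Q.ex_awalk_iff[OF ne] walk by blast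
  then show "successively (\<lambda>x y. y = next_at x) w"
    by (rule successively_mono) (simp only: set head_Q tail_Q step)
  have "u = tail Q (hd w)" using walk ne by (cases w) (auto simp: Q.awalk_Cons_iff)
  moreover have "u = head Q (last w)"
    using Q.awalk_verts_conv'[OF cas] ne walk Q.awlast_if_cas[OF cas] by (simp add: last_map)
  ultimately show "hd w = next_at (last w)"
    using step[of "last w" "hd w"] ne set by (metis hd_in_set last_in_set tail_Q)
qed

abbreviation omegas :: "'e half_edge list set" where
  "omegas \<equiv> omega Q ` arcs Q"

text \<open>A common interface to the cyclic case and to the segments: the study of the components
  uses the paths \<open>omega Q a\<close> only through these properties.\<close>

lemma omega_properties:
  assumes a: "a \<in> arcs Q"
  shows "set (omega Q a) \<subseteq> arcs Q" "a \<in> set (omega Q a)" "distinct (omega Q a)"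
    "successively (\<lambda>x y. y = next_at x) (omega Q a)"
    "b \<in> set (omega Q a) \<Longrightarrow> omega Q b = omega Q a"
    "\<exists>w \<in> omegas. hd w = next_at (last (omega Q a))"
proof -
  have "set (omega Q a) \<subseteq> arcs Q \<and> a \<in> set (omega Q a) \<and> distinct (omega Q a) \<and>
    successively (\<lambda>x y. y = next_at x) (omega Q a) \<and>
    (\<forall>b \<in> set (omega Q a). omega Q b = omega Q a) \<and>
    (\<exists>w \<in> omegas. hd w = next_at (last (omega Q a)))"
  proof (cases "cyclic_quiver Q")
    case True
    then have const: "omega Q b = (SOME w. full_cycle Q w)" for b by (simp add: omega_def)
    have "full_cycle Q (omega Q a)"
      using True unfolding const cyclic_quiver_def by (rule someI_ex)
    note w = full_cycle_successively[OF this]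
    have "omega Q a \<in> omegas" using a by (rule imageI)
    \<comment> \<open>In a cyclic quiver the chosen cycle is followed by itself.\<close>
    then have "\<exists>w \<in> omegas. hd w = next_at (last (omega Q a))" using w(5) by blast
    moreover have "omega Q b = omega Q a" for b unfolding const ..
    ultimately show ?thesis using w(2-4) a by blast
  next
    case False
    obtain r where r: "r \<in> arcs Q" "ramified r" "a \<in> set (segment r)"
      using ex_segment[OF False a] .
    note omega = omega_segment[OF False r(1,2)]
    let ?n = "segment_length r"
    let ?r = "(next_at ^^ ?n) r"
    note n = segment_length[OF r(1,2)]
    have "distinct (segment r)"
    proof -
      \<comment> \<open>A repetition would bring the ramified half-edge \<open>r\<close> back before
        the segment ends.\<close>
      have "(next_at ^^ i) r \<noteq> (next_at ^^ j) r" if "i < j" "j < ?n" for i j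
      proof
        assume "(next_at ^^ i) r = (next_at ^^ j) r"
        then have "(next_at ^^ i) r = (next_at ^^ i) ((next_at ^^ (j - i)) r)"
          using that(1) unfolding funpow_funpow by simp
        then have "r = (next_at ^^ (j - i)) r"
          using funpow_next_at_eqD r(1) funpow_next_at_arcs(1) by blast
        then show False using not_ramified_segment[of "j - i" r] that r(2) by (simp add: less_imp_diff_less)
      qed
      then show ?thesis
        unfolding distinct_conv_nth segment_def by (metis length_iterates linorder_neqE_nat nth_iterates)
    qed
    moreover have "set (segment r) \<subseteq> arcs Q"
      using funpow_next_at_arcs(1)[OF r(1)] by (auto simp: segment_def set_iterates)
    moreover have "\<exists>w \<in> omegas. hd w = next_at (last (segment r))"
    proof -
      \<comment> \<open>\<open>?r\<close> is ramified and therefore starts the next segment.\<close>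
      have r': "?r \<in> arcs Q" using funpow_next_at_arcs(1)[OF r(1)] .
      have hd: "hd (segment ?r) = ?r" "?r \<in> set (segment ?r)"
        using segment_length(1)[OF r' n(2)] by (auto simp: segment_def hd_iterates set_iterates intro: image_eqI[of _ _ 0])
      then have "omega Q ?r = segment ?r" using omega_segment[OF False r' n(2)] by blast
      then have "segment ?r \<in> omegas" using r' by (rule image_eqI[OF sym])
      moreover have "next_at (last (segment r)) = ?r"
        using n(1) by (cases ?n) (simp_all add: segment_def last_iterates)
      ultimately show ?thesis using hd(1) by auto
    qed
    moreover have "successively (\<lambda>x y. y = next_at x) (segment r)"
      unfolding segment_def by (rule successively_iterates)
    ultimately show ?thesis using omega r(3) by simp
  qed
  then show "set (omega Q a) \<subseteq> arcs Q" "a \<in> set (omega Q a)" "distinct (omega Q a)"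
    "successively (\<lambda>x y. y = next_at x) (omega Q a)"
    "b \<in> set (omega Q a) \<Longrightarrow> omega Q b = omega Q a"
    "\<exists>w \<in> omegas. hd w = next_at (last (omega Q a))"
    by blast+
qed

end

section \<open>Components of the ramifications graph\<close>

context brauer
begin

text \<open>All arrows of such a path share their vertex, so the first one represents it; see
  \<open>end_of_omega\<close>.\<close>

definition omegas_at :: "'v \<Rightarrow> 'e half_edge list set" where
  "omegas_at v = {w \<in> omegas. end_of \<G> (hd w) = v}"

definition next_omega :: "'e half_edge list \<Rightarrow> 'e half_edge list" where
  "next_omega w = omega Q (next_at (last w))"

lemma omegasD:
  assumes "w \<in> omegas"
  shows "w \<noteq> []" "set w \<subseteq> arcs Q" "distinct w" "successively (\<lambda>x y. y = next_at x) w"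
    "b \<in> set w \<Longrightarrow> omega Q b = w"
proof -
  obtain a where a: "a \<in> arcs Q" "w = omega Q a" using assms by blast
  note props = omega_properties[OF a(1), folded a(2)]
  show "w \<noteq> []" using props(2) by auto
  show "set w \<subseteq> arcs Q" "distinct w" "successively (\<lambda>x y. y = next_at x) w" by fact+
  show "omega Q b = w" if "b \<in> set w" using props(5)[OF that] .
qed

lemma next_omega:
  assumes "w \<in> omegas"
  shows "next_omega w \<in> omegas" "hd (next_omega w) = next_at (last w)"
proof -
  obtain w' where w': "w' \<in> omegas" "hd w' = next_at (last w)"
    using assms omega_properties(6) by blast
  then have "next_omega w = w'"
    unfolding next_omega_def by (metis hd_in_set omegasD(1,5))
  with w' show "next_omega w \<in> omegas" "hd (next_omega w) = next_at (last w)" by simp_all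
qed

text \<open>An arrow determines the path through it, so a member of \<open>omegas\<close> is known
  from its first arrow.\<close>

lemma hd_eq_next_iff:
  assumes "w \<in> omegas" "w' \<in> omegas"
  shows "hd w' = next_at (last w) \<longleftrightarrow> w' = next_omega w"
  using assms next_omega(2) unfolding next_omega_def by (metis hd_in_set omegasD(1,5))

lemma end_of_omega:
  assumes "w \<in> omegas" "x \<in> set w"
  shows "end_of \<G> x = end_of \<G> (hd w)"
proof -
  have "w = iterates next_at (hd w) (length w)"
    using omegasD(1,4)[OF assms(1)] by (intro successively_eq_iterates)
  then have "set w = (\<lambda>k. (next_at ^^ k) (hd w)) ` {..<length w}"
    using set_iterates[of next_at "hd w" "length w"] by argo
  then obtain k where "x = (next_at ^^ k) (hd w)"
    using assms(2) by blast
  moreover have "hd w \<in> arcs Q" using omegasD(1,2)[OF assms(1)] by auto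
  ultimately show ?thesis by (simp add: funpow_next_at_arcs)
qed

lemma omegas_atD: "w \<in> omegas_at v \<Longrightarrow> w \<in> omegas" "w \<in> omegas_at v \<Longrightarrow> end_of \<G> (hd w) = v"
  by (simp_all add: omegas_at_def)

lemma finite_omegas_at: "finite (omegas_at v)"
  by (rule finite_subset[of _ omegas]) (auto simp: omegas_at_def)

lemma next_omega_omegas_at:
  assumes "w \<in> omegas_at v"
  shows "next_omega w \<in> omegas_at v"
proof -
  note w = omegas_atD[OF assms]
  have last: "last w \<in> set w" using omegasD(1)[OF w(1)] by simp
  then have "last w \<in> arcs Q" using omegasD(2)[OF w(1)] by blast
  then have "end_of \<G> (next_at (last w)) = v"
    using next_at_arcs(2) end_of_omega[OF w(1) last] w(2) by simp
  then show ?thesis using next_omega[OF w(1)] by (simp add: omegas_at_def)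
qed

lemma omega_in_omegas_at:
  assumes "a \<in> arcs Q"
  shows "omega Q a \<in> omegas_at (end_of \<G> a)"
proof -
  have "omega Q a \<in> omegas" using assms by (rule imageI)
  then show ?thesis
    using end_of_omega[OF _ omega_properties(2)[OF assms]] by (simp add: omegas_at_def)
qed

lemma Union_omegas_at:
  assumes "v \<in> nontruncated_verts \<G>"
  shows "\<Union>(set ` omegas_at v) = half_edges_at \<G> v"
proof
  show "\<Union>(set ` omegas_at v) \<subseteq> half_edges_at \<G> v"
  proof
    fix x assume "x \<in> \<Union>(set ` omegas_at v)"
    then obtain w where w: "w \<in> omegas_at v" "x \<in> set w" by blast
    then have "x \<in> arcs Q" "end_of \<G> x = v"
      using omegasD(2)[OF omegas_atD(1)[OF w(1)]] end_of_omega[OF omegas_atD(1)[OF w(1)]]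
        omegas_atD(2)[OF w(1)] by auto
    then show "x \<in> half_edges_at \<G> v" using half_edges_at_iff[OF assms] by simp
  qed
  show "half_edges_at \<G> v \<subseteq> \<Union>(set ` omegas_at v)"
  proof
    fix x assume "x \<in> half_edges_at \<G> v"
    then have "x \<in> arcs Q" "end_of \<G> x = v" using half_edges_at_iff[OF assms] by simp_all
    then show "x \<in> \<Union>(set ` omegas_at v)"
      using omega_in_omegas_at omega_properties(2) by blast
  qed
qed

text \<open>The arrows lying on the orbit of \<open>w\<close> under \<open>next_omega\<close> are closed under \<open>next_at\<close>.\<close>

lemma cyclic_on_next_omega:
  assumes v: "v \<in> nontruncated_verts \<G>"
  shows "cyclic_on next_omega (omegas_at v)"
proof -
  obtain h where "h \<in> half_edges_at \<G> v" using cyclic_on_next_at[OF v] by (auto simp: cyclic_on_def)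
  then obtain w where w: "w \<in> omegas_at v" using Union_omegas_at[OF v] by blast
  have orbit: "orbit next_omega w \<subseteq> omegas_at v"
  proof
    fix x assume "x \<in> orbit next_omega w"
    then show "x \<in> omegas_at v" by induction (use w next_omega_omegas_at in auto)
  qed
  let ?X = "\<Union>(set ` orbit next_omega w)"
  \<comment> \<open>Inside a path the successor is the next arrow; after the last arrow it is the
    first one of \<open>next_omega w'\<close>.\<close>
  have closed: "next_at x \<in> ?X" if x: "x \<in> ?X" for x
  proof -
    obtain w' where w': "w' \<in> orbit next_omega w" "x \<in> set w'" using x by blast
    then have omegas: "w' \<in> omegas" using orbit omegas_atD(1) by blast
    obtain i where i: "i < length w'" "x = w' ! i" using w'(2) by (auto simp: in_set_conv_nth)
    show ?thesis
    proof (cases "Suc i < length w'")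
      case True
      then have "next_at x = w' ! Suc i" using successively_nth[OF omegasD(4)[OF omegas] True] i by simp
      then show ?thesis using True w'(1) by force
    next
      case False
      then have "x = last w'" using i by (metis Suc_lessI diff_Suc_1 last_conv_nth list.size(3) not_less_zero)
      then have "next_at x \<in> set (next_omega w')"
        using next_omega[OF omegas] omegasD(1) by (metis hd_in_set)
      then show ?thesis using orbit.step[OF w'(1)] by blast
    qed
  qed
  have "omegas_at v \<subseteq> orbit next_omega w"
  proof
    fix w' assume w': "w' \<in> omegas_at v"
    \<comment> \<open>\<open>next_omega w\<close> lies on the orbit by definition, whereas
      \<open>w\<close> itself lies on it only if it recurs.\<close>
    let ?x = "hd (next_omega w)"
    have base: "next_omega w \<in> orbit next_omega w" by (rule orbit.base)
    have x: "?x \<in> ?X" using base omegasD(1)[OF omegas_atD(1)[OF next_omega_omegas_at[OF w]]] by fastforce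
    then have "?x \<in> half_edges_at \<G> v" using orbit Union_omegas_at[OF v] by blast
    moreover have hd: "hd w' \<in> set w'" using omegasD(1)[OF omegas_atD(1)[OF w']] by simp
    then have "hd w' \<in> half_edges_at \<G> v" using w' Union_omegas_at[OF v] by blast
    ultimately have "hd w' \<in> orbit next_at ?x" using orbit_cyclic_eq3[OF cyclic_on_next_at[OF v]] by simp
    then have "hd w' \<in> ?X" by induction (use closed x in auto)
    then obtain w'' where w'': "w'' \<in> orbit next_omega w" "hd w' \<in> set w''" by blast
    then have "w'' = w'"
      using omegasD(5) hd omegas_atD(1) w' orbit by (metis subsetD)
    with w'' show "w' \<in> orbit next_omega w" by simp
  qed
  with orbit w show ?thesis unfolding cyclic_on_def by blast
qed

section \<open>The ramifications graph and its weak components\<close>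

definition ram_graph :: "('e half_edge list, 'e half_edge list \<times> 'e half_edge list) pre_digraph" where
  "ram_graph = with_proj
    \<lparr> pverts = omegas, parcs = {(w, w'). w \<in> omegas \<and> w' = next_omega w \<and> w \<noteq> w'} \<rparr>"

definition component_at ::
    "'v \<Rightarrow> ('e half_edge list, 'e half_edge list \<times> 'e half_edge list) pre_digraph" where
  "component_at v = with_proj
    \<lparr> pverts = omegas_at v, parcs = {(w, w'). w \<in> omegas_at v \<and> w' = next_omega w \<and> w \<noteq> w'} \<rparr>"

text \<open>By \<open>path_elem_in_brauer_ideal_iff\<close>, composability and non-membership
  together say that the first arrow of \<open>w'\<close> is the successor of the last arrow of
  \<open>w\<close>.\<close>

lemma ramifications_graph_eq:
  "ramifications_graph Q (brauer_ideal \<G> :: ('e \<times> 'e half_edge list \<Rightarrow> 'k::field) set) = ram_graph"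
proof -
  have "(head Q (last w) = tail Q (hd w') \<and>
      (path_elem Q [last w, hd w'] :: _ \<Rightarrow> 'k) \<notin> brauer_ideal \<G>) \<longleftrightarrow> w' = next_omega w"
    if w: "w \<in> omegas" "w' \<in> omegas" for w w'
  proof -
    have "last w \<in> arcs Q" "hd w' \<in> arcs Q"
      using omegasD(1,2)[OF w(1)] omegasD(1,2)[OF w(2)] by auto
    then show ?thesis
      unfolding hd_eq_next_iff[OF w, symmetric]
      using path_elem_in_brauer_ideal_iff[of "last w" "hd w'", where 'k = 'k] by auto
  qed
  then have "{(w, w'). w \<in> omegas \<and> w' \<in> omegas \<and> w \<noteq> w' \<and> head Q (last w) = tail Q (hd w') \<and>
      (path_elem Q [last w, hd w'] :: _ \<Rightarrow> 'k) \<notin> brauer_ideal \<G>} =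
    {(w, w'). w \<in> omegas \<and> w' = next_omega w \<and> w \<noteq> w'}"
    using next_omega(1) by blast
  then show ?thesis unfolding ramifications_graph_def ram_graph_def by simp
qed

lemma wf_ram_graph: "wf_digraph ram_graph"
  by unfold_locales (use next_omega(1) in \<open>auto simp: ram_graph_def\<close>)

lemma wf_component_at: "wf_digraph (component_at v)"
  by unfold_locales (use next_omega_omegas_at in \<open>auto simp: component_at_def\<close>)

lemma subgraph_component_at: "subgraph (component_at v) ram_graph"
  by (rule subgraphI[OF _ _ _ wf_component_at wf_ram_graph])
    (auto simp: component_at_def ram_graph_def compatible_def omegas_at_def)

lemma connected_component_at:
  assumes v: "v \<in> nontruncated_verts \<G>"
  shows "connected (component_at v)"
proof -
  interpret N: wf_digraph "component_at v" by (rule wf_component_at)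
  have reach: "x \<rightarrow>\<^sup>*\<^bsub>component_at v\<^esub> (next_omega ^^ n) x \<and> (next_omega ^^ n) x \<in> omegas_at v"
    if x: "x \<in> omegas_at v" for x n
  proof (induction n)
    case 0
    have "x \<in> verts (component_at v)" using x by (simp add: component_at_def)
    then show ?case using x N.reachable_refl by simp
  next
    case (Suc n)
    let ?y = "(next_omega ^^ n) x"
    \<comment> \<open>Loops are excluded, so a fixed point of \<open>next_omega\<close> gives no
      arc; reflexivity takes over there.\<close>
    have "?y \<rightarrow>\<^sup>*\<^bsub>component_at v\<^esub> next_omega ?y"
    proof (cases "next_omega ?y = ?y")
      case True
      have "?y \<in> verts (component_at v)" using Suc by (simp add: component_at_def)
      then show ?thesis unfolding True by (rule N.reachable_refl)
    next
      case False
      then have "(?y, next_omega ?y) \<in> arcs_ends (component_at v)"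
        using Suc by (auto simp: component_at_def)
      then show ?thesis by (rule N.reachable_adjI)
    qed
    then show ?case using Suc N.reachable_trans next_omega_omegas_at by auto
  qed
  have "strongly_connected (component_at v)"
  proof (rule strongly_connectedI)
    show "verts (component_at v) \<noteq> {}"
      using cyclic_on_next_omega[OF v] by (auto simp: component_at_def cyclic_on_def)
    fix x y assume "x \<in> verts (component_at v)" "y \<in> verts (component_at v)"
    then have xy: "x \<in> omegas_at v" "y \<in> omegas_at v" by (simp_all add: component_at_def)
    then have "y \<in> orbit next_omega x" using orbit_cyclic_eq3[OF cyclic_on_next_omega[OF v]] by simp
    then show "x \<rightarrow>\<^sup>*\<^bsub>component_at v\<^esub> y" using reach[OF xy(1)] by (auto simp: orbit_altdef)
  qed
  then show ?thesis by (rule N.strongly_connected_imp_connected)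
qed

text \<open>Every arc of the ramifications graph joins two paths at the same vertex, so membership
  in \<open>omegas_at v\<close> spreads from \<open>w\<close> to all of the connected
  \<open>N\<close>.\<close>

lemma subgraph_component_atI:
  assumes N: "subgraph N ram_graph" "connected N" and w: "w \<in> verts N" "w \<in> omegas_at v"
  shows "subgraph N (component_at v)"
proof -
  have sub: "verts N \<subseteq> omegas" "arcs N \<subseteq> arcs ram_graph" "compatible ram_graph N" "wf_digraph N"
    using N(1) by (auto simp: subgraph_def ram_graph_def)
  have ends: "tail N = fst" "head N = snd"
    using sub(3) by (auto simp: compatible_def ram_graph_def)
  have "x \<in> omegas_at v" if "x \<in> verts N" for x
  proof (rule connected_invariant[OF N(2), of "\<lambda>x. x \<in> omegas_at v" w])
    fix a assume "a \<in> arcs N"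
    then obtain y where y: "y \<in> omegas" "a = (y, next_omega y)" using sub(2) by (auto simp: ram_graph_def)
    have "y \<in> omegas_at (end_of \<G> (hd y))" using y(1) by (simp add: omegas_at_def)
    with next_omega_omegas_at[OF this]
    have "y \<in> omegas_at v \<longleftrightarrow> next_omega y \<in> omegas_at v" by (auto simp: omegas_at_def)
    then show "tail N a \<in> omegas_at v \<longleftrightarrow> head N a \<in> omegas_at v" by (simp add: ends y(2))
  qed (use w that in auto)
  then have verts: "verts N \<subseteq> omegas_at v" by blast
  moreover have "arcs N \<subseteq> arcs (component_at v)"
  proof
    fix a assume a: "a \<in> arcs N"
    then have "fst a \<in> omegas_at v" using verts wf_digraph.tail_in_verts[OF sub(4) a] ends by auto
    then show "a \<in> arcs (component_at v)" using a sub(2) by (auto simp: ram_graph_def component_at_def)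
  qed
  ultimately show ?thesis
    by (intro subgraphI wf_component_at sub(4)) (auto simp: component_at_def compatible_def ends)
qed

text \<open>By \<open>subgraph_component_atI\<close> a connected subgraph meeting
  \<open>omegas_at v\<close> lies inside \<open>component_at v\<close>; so these graphs are maximal,
  and there are no other maximal ones.\<close>

lemma weak_components_ram_graph:
  "weak_components ram_graph = component_at ` nontruncated_verts \<G>"
proof -
  have antisym: "G = H" if "subgraph G H" "subgraph H G"
    for G H :: "('e half_edge list, 'e half_edge list \<times> 'e half_edge list) pre_digraph"
    using that by (intro pre_digraph.equality) (auto simp: subgraph_def compatible_def)
  have "component_at v \<in> weak_components ram_graph" if v: "v \<in> nontruncated_verts \<G>" for v
  proof -
    have "N = component_at v"
      if N: "subgraph (component_at v) N" "subgraph N ram_graph" "connected N" for N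
    proof -
      obtain w where "w \<in> omegas_at v" using cyclic_on_next_omega[OF v] by (auto simp: cyclic_on_def)
      moreover from this have "w \<in> verts N" using N(1) by (auto simp: subgraph_def component_at_def)
      ultimately show ?thesis using subgraph_component_atI N antisym by blast
    qed
    then show ?thesis
      using subgraph_component_at connected_component_at[OF v]
      by (auto simp: weak_components_def pre_digraph.max_subgraph_def)
  qed
  moreover have "N \<in> component_at ` nontruncated_verts \<G>" if "N \<in> weak_components ram_graph" for N
  proof -
    have N: "subgraph N ram_graph" "connected N"
        "\<And>N'. N' \<noteq> N \<Longrightarrow> subgraph N N' \<Longrightarrow> \<not> (subgraph N' ram_graph \<and> connected N')"
      using that by (auto simp: weak_components_def pre_digraph.max_subgraph_def)
    obtain w where w: "w \<in> verts N" using N(2) by (auto simp: connected_def strongly_connected_def)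
    then have "w \<in> omegas" using N(1) by (auto simp: subgraph_def ram_graph_def)
    then obtain a where a: "a \<in> arcs Q" "w = omega Q a" by blast
    note v = in_half_edges_at_end_of(1)[OF a(1)]
    have "subgraph N (component_at (end_of \<G> a))"
      using subgraph_component_atI N(1,2) w omega_in_omegas_at[OF a(1)] a(2) by blast
    then have "component_at (end_of \<G> a) = N"
      using N(3) subgraph_component_at connected_component_at[OF v] by blast
    then show ?thesis using v by blast
  qed
  ultimately show ?thesis by blast
qed

lemma inj_on_component_at: "inj_on component_at (nontruncated_verts \<G>)"
proof (rule inj_onI)
  fix u v assume u: "u \<in> nontruncated_verts \<G>" and "component_at u = component_at v"
  then have "verts (component_at u) = verts (component_at v)" by simp
  then have eq: "omegas_at u = omegas_at v" by (simp add: component_at_def)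
  obtain w where "w \<in> omegas_at u" using cyclic_on_next_omega[OF u] by (auto simp: cyclic_on_def)
  with eq show "u = v" by (auto simp: omegas_at_def)
qed

text \<open>\<open>next_omega\<close> permutes \<open>omegas_at v\<close> in a single cycle. With
  one element the only possible arc is an excluded loop; with more, iterating
  \<open>next_omega\<close> enumerates an oriented cycle.\<close>

lemma component_at_shape:
  assumes v: "v \<in> nontruncated_verts \<G>"
  shows "(\<exists>w. verts (component_at v) = {w} \<and> arcs (component_at v) = {}) \<or>
    (\<exists>ws. length ws \<ge> 2 \<and> oriented_cycle_of (component_at v) ws)"
proof -
  note cyc = cyclic_on_next_omega[OF v]
  obtain w where w: "w \<in> omegas_at v" using cyc by (auto simp: cyclic_on_def)
  let ?n = "card (omegas_at v)"
  let ?ws = "iterates next_omega w ?n"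
  note ws = iterates_cyclic_on[OF cyc finite_omegas_at w]
  show ?thesis
  proof (cases "?n = 1")
    case True
    then obtain x where "omegas_at v = {x}" by (rule card_1_singletonE)
    then have eq: "omegas_at v = {w}" using w by (simp only: singleton_iff)
    moreover have "next_omega w = w" using next_omega_omegas_at[OF w] unfolding eq by (rule singletonD)
    ultimately have "verts (component_at v) = {w}" "arcs (component_at v) = {}"
      by (simp_all add: component_at_def)
    then show ?thesis by blast
  next
    case False
    have "?n \<noteq> 0" using w finite_omegas_at by auto
    with False have n: "2 \<le> ?n" by linarith
    \<comment> \<open>A cyclic permutation with a fixed point acts on a singleton.\<close>
    have neq: "next_omega x \<noteq> x" if "x \<in> omegas_at v" for x
      using False by (rule contrapos_nn) (use eq_on_cyclic_on_iff1[OF cyc that] in metis)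
    have "rotate1 ?ws = map next_omega ?ws"
      by (rule rotate1_iterates) (rule cyclic_on_funpow_card[OF cyc w])
    then have "set (zip ?ws (rotate1 ?ws)) = (\<lambda>x. (x, next_omega x)) ` omegas_at v"
      by (simp only: set_zip_map ws(1))
    moreover have "arcs (component_at v) = (\<lambda>x. (x, next_omega x)) ` omegas_at v"
      using neq by (force simp: component_at_def)
    ultimately have "oriented_cycle_of (component_at v) ?ws"
      using ws n by (auto simp: oriented_cycle_of_def component_at_def)
    then show ?thesis using n by (intro disjI2 exI[of _ ?ws]) simp
  qed
qed

text \<open>Whichever enumeration is chosen, its concatenation runs by successor steps through every
  half-edge at \<open>v\<close> exactly once, so it is the special cycle starting at its own first
  entry.\<close>

lemma omega_component_at:
  assumes v: "v \<in> nontruncated_verts \<G>"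
  shows "\<exists>h \<in> half_edges_at \<G> v. omega_component (component_at v) = special_cycle \<G> v h"
proof -
  let ?P = "\<lambda>ws. chain_of (component_at v) ws \<or> oriented_cycle_of (component_at v) ws"
  define ws where "ws = (SOME ws. ?P ws)"
  have "\<exists>ws. ?P ws"
  proof -
    \<comment> \<open>A vertex without arcs counts as a chain; an oriented cycle of length one would
      need a loop.\<close>
    have "?P [w]" if "verts (component_at v) = {w}" "arcs (component_at v) = {}" for w
      using that by (simp add: chain_of_def)
    then show ?thesis using component_at_shape[OF v] by blast
  qed
  then have "?P ws" unfolding ws_def by (rule someI_ex)
  then have ws: "ws \<noteq> []" "distinct ws" "set ws = omegas_at v"
    and arcs: "set (zip ws (tl ws)) \<subseteq> arcs (component_at v) \<or> set (zip ws (rotate1 ws)) \<subseteq> arcs (component_at v)"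
    by (auto simp: chain_of_def oriented_cycle_of_def component_at_def)
  have in_omegas: "w \<in> omegas" if "w \<in> set ws" for w
    using that by (auto simp: ws(3) omegas_at_def)
  have "successively (\<lambda>v w. hd w = next_at (last v)) ws"
    unfolding successively_conv_nth
  proof (intro allI impI)
    fix i assume i: "Suc i < length ws"
    have "(ws ! i, ws ! Suc i) \<in> arcs (component_at v)"
      using arcs
    proof
      assume "set (zip ws (tl ws)) \<subseteq> arcs (component_at v)"
      moreover have "(ws ! i, ws ! Suc i) \<in> set (zip ws (tl ws))"
        using i by (auto simp: in_set_zip nth_tl intro!: exI[of _ i])
      ultimately show ?thesis by blast
    next
      assume "set (zip ws (rotate1 ws)) \<subseteq> arcs (component_at v)"
      moreover have "(ws ! i, ws ! Suc i) \<in> set (zip ws (rotate1 ws))"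
        using i by (auto simp: in_set_zip nth_rotate1 intro!: exI[of _ i])
      ultimately show ?thesis by blast
    qed
    then have "ws ! Suc i = next_omega (ws ! i)" by (simp add: component_at_def)
    then show "hd (ws ! Suc i) = next_at (last (ws ! i))"
      using next_omega(2) in_omegas i by simp
  qed
  then have succ: "successively (\<lambda>x y. y = next_at x) (concat ws)"
    using in_omegas omegasD(1,4) by (intro successively_concat) blast+
  have set: "set (concat ws) = half_edges_at \<G> v"
    using Union_omegas_at[OF v] ws(3) by simp
  have "distinct (concat ws)"
  proof (rule distinct_concat)
    fix x y assume xy: "x \<in> set ws" "y \<in> set ws" "x \<noteq> y"
    \<comment> \<open>Paths in \<open>omegas\<close> that share an arrow coincide.\<close>
    show "set x \<inter> set y = {}"
      using omegasD(5)[OF in_omegas[OF xy(1)]] omegasD(5)[OF in_omegas[OF xy(2)]] xy(3) by blast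
  qed (use ws(2) in_omegas omegasD(3) in auto)
  then have len: "length (concat ws) = val \<G> v"
    using distinct_card set unfolding val_def by metis
  have ne: "concat ws \<noteq> []" using ws(1) in_omegas omegasD(1) by (cases ws) auto
  then have hd: "hd (concat ws) \<in> half_edges_at \<G> v" using set hd_in_set by metis
  then have "concat ws = special_cycle \<G> v (hd (concat ws))"
    using successively_eq_iterates[OF succ ne] unfolding special_cycle_eq_iterates[OF v hd] len by blast
  then show ?thesis using hd unfolding omega_component_def ws_def[symmetric] by blast
qed

end

theorem theorem5p1:
  fixes \<G> :: "('v,'e) brauer_graph"
    and I :: "('e \<times> 'e half_edge list \<Rightarrow> 'k::alg_closed_field) set"
    and R :: "('e half_edge list, 'e half_edge list \<times> 'e half_edge list) pre_digraph"
  assumes "is_brauer_graph \<G>"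
    and "I = brauer_ideal \<G>"
    and "R = ramifications_graph (brauer_quiver \<G>) I"
  shows "(\<exists>\<phi>. bij_betw \<phi> (weak_components R) (nontruncated_verts \<G>) \<and>
            (\<forall>N \<in> weak_components R. \<exists>h \<in> half_edges_at \<G> (\<phi> N).
               omega_component N = special_cycle \<G> (\<phi> N) h)) \<and>
         (\<forall>N \<in> weak_components R.
            (\<exists>w. verts N = {w} \<and> arcs N = {}) \<or>
            (\<exists>ws. length ws \<ge> 2 \<and> oriented_cycle_of N ws))"
proof -
  interpret brauer \<G> by unfold_locales fact
  have R: "weak_components R = component_at ` nontruncated_verts \<G>"
    unfolding assms(2,3) ramifications_graph_eq by (rule weak_components_ram_graph)
  let ?\<phi> = "inv_into (nontruncated_verts \<G>) component_at"
  have "bij_betw ?\<phi> (weak_components R) (nontruncated_verts \<G>)"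
    unfolding R by (intro bij_betw_inv_into inj_on_imp_bij_betw inj_on_component_at)
  moreover have "\<exists>h \<in> half_edges_at \<G> (?\<phi> N). omega_component N = special_cycle \<G> (?\<phi> N) h"
    if "N \<in> weak_components R" for N
    using that omega_component_at unfolding R
    by (auto simp: inv_into_f_f[OF inj_on_component_at])
  ultimately show ?thesis using component_at_shape unfolding R by blast
qed

end
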